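(* Let $h:\Sigma^n\to\Sigma$ be an $n$-quasigroup, let $\Sigma=\{a,b,c,d\}$, and let $Q$ be the set of all $n$-quasigroups $f$ such that $f(\bar x)=h(\bar x)$ for every $\bar x=(x_1,\ldots,x_n)\in\Sigma^n$ with $x_n\in\{a,b\}$. If $2<|Q|<2^{2^{n-1}}$, then $h$ is reducible. If $|Q|=2^{2^{n-1}}$, then $h$ is semilinear.
   Context: Let $\Sigma=\{0,1,2,3\}$, $[n]=\{1,\ldots,n\}$. An $n$-quasigroup is a map $g:\Sigma^n\to\Sigma$ such that, for each $i$ and each fixing of the other arguments, $x_i\mapsto g(\bar x)$ is a bijection of $\Sigma$. For $K=\{i_1<\cdots<i_m\}\subseteq[n]$, $\bar x_K=(x_{i_1},\ldots,x_{i_m})$. An $n$-quasigroup $g$ is reducible if there exist $k'$ with $2\le k'\le n-1$, a partition $\{L_1,\ldots,L_{k'}\}$ of $[n]$ into nonempty sets, a $k'$-quasigroup $f_0$ and $|L_j|$-quasigroups $f_j$ with $g(\bar x)=f_0(f_1(\bar x_{L_1}),\ldots,f_{k'}(\bar x_{L_{k'}}))$. An $i$-line of $\Sigma^m$ is a set of four words agreeing except in coordinate $i$. An MDS code in $\Sigma^m$ is a set meeting every line in exactly one element; a double-MDS-code is a set meeting every line in exactly two elements; a double-MDS-code $D\subseteq\Sigma^m$ is linear if its characteristic function satisfies $\chi_D(y_1,\ldots,y_m)=\chi_1(y_1)\oplus\cdots\oplus\chi_m(y_m)$ (mod 2) for some $\chi_i:\Sigma\to\{0,1\}$; an MDS code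 is semilinear if contained in a linear double-MDS-code; an $n$-quasigroup $g$ is semilinear if $\{(\bar x,g(\bar x)):\bar x\in\Sigma^n\}\subseteq\Sigma^{n+1}$ is semilinear. *)

theory Defs
  imports Main
begin

text \<open>Alphabet Sigma = {0,1,2,3}; words of length n are lists; coordinates are 0-indexed
  (coordinate i of the paper is list index i-1).\<close>

definition Sig :: "nat set" where
  "Sig = {0, 1, 2, 3}"

definition words :: "nat \<Rightarrow> nat list set" where
  "words n = {xs. length xs = n \<and> set xs \<subseteq> Sig}"

definition is_quasigroup :: "nat \<Rightarrow> (nat list \<Rightarrow> nat) \<Rightarrow> bool" where
  "is_quasigroup n g \<longleftrightarrow>
     (\<forall>x\<in>words n. g x \<in> Sig) \<and>
     (\<forall>i<n. \<forall>x\<in>words n. bij_betw (\<lambda>y. g (x[i := y])) Sig Sig)"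

definition reducible :: "nat \<Rightarrow> (nat list \<Rightarrow> nat) \<Rightarrow> bool" where
  "reducible n g \<longleftrightarrow>
     (\<exists>k' L f0 fs. 2 \<le> k' \<and> k' \<le> n - 1 \<and>
        (\<forall>j<k'. L j \<noteq> {}) \<and>
        (\<forall>j<k'. \<forall>j'<k'. j \<noteq> j' \<longrightarrow> L j \<inter> L j' = {}) \<and>
        (\<Union>j<k'. L j) = {0..<n} \<and>
        is_quasigroup k' f0 \<and>
        (\<forall>j<k'. is_quasigroup (card (L j)) (fs j)) \<and>
        (\<forall>x\<in>words n. g x = f0 (map (\<lambda>j. fs j (nths x (L j))) [0..<k'])))"

definition line :: "nat \<Rightarrow> nat \<Rightarrow> nat list \<Rightarrow> nat list set" where
  "line m i x = {x[i := y] | y. y \<in> Sig}"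

definition lines :: "nat \<Rightarrow> nat list set set" where
  "lines m = {line m i x | i x. i < m \<and> x \<in> words m}"

definition MDS_code :: "nat \<Rightarrow> nat list set \<Rightarrow> bool" where
  "MDS_code m C \<longleftrightarrow> C \<subseteq> words m \<and> (\<forall>l\<in>lines m. card (C \<inter> l) = 1)"

definition double_MDS_code :: "nat \<Rightarrow> nat list set \<Rightarrow> bool" where
  "double_MDS_code m D \<longleftrightarrow> D \<subseteq> words m \<and> (\<forall>l\<in>lines m. card (D \<inter> l) = 2)"

definition linear_double_MDS_code :: "nat \<Rightarrow> nat list set \<Rightarrow> bool" where
  "linear_double_MDS_code m D \<longleftrightarrow> double_MDS_code m D \<and>
     (\<exists>\<chi> :: nat \<Rightarrow> nat \<Rightarrow> nat. (\<forall>i<m. \<forall>y\<in>Sig. \<chi> i y \<in> {0, 1}) \<and>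
        (\<forall>y\<in>words m. (y \<in> D) \<longleftrightarrow> (\<Sum>i<m. \<chi> i (y ! i)) mod 2 = 1))"

definition semilinear_code :: "nat \<Rightarrow> nat list set \<Rightarrow> bool" where
  "semilinear_code m C \<longleftrightarrow> MDS_code m C \<and>
     (\<exists>D. linear_double_MDS_code m D \<and> C \<subseteq> D)"

definition semilinear :: "nat \<Rightarrow> (nat list \<Rightarrow> nat) \<Rightarrow> bool" where
  "semilinear n g \<longleftrightarrow> semilinear_code (Suc n) {x @ [g x] | x. x \<in> words n}"

text \<open>Q: the n-quasigroups agreeing with h on words whose last coordinate is in {a,b};
  quasigroups are identified with their restriction to Sigma^n.\<close>
definition Qset :: "nat \<Rightarrow> (nat list \<Rightarrow> nat) \<Rightarrow> nat \<Rightarrow> nat \<Rightarrow> (nat list \<Rightarrow> nat) set" where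
  "Qset n h a b = {(\<lambda>x. if x \<in> words n then f x else undefined) | f.
      is_quasigroup n f \<and> (\<forall>x\<in>words n. x ! (n - 1) \<in> {a, b} \<longrightarrow> f x = h x)}"

end

theory Submission
  imports Defs
begin

text \<open>
  The values \<open>f(x, c)\<close>, \<open>f(x, d)\<close> of a completion \<open>f\<close> of \<open>h\<close> exhaust the double-MDS-code
  \<open>D = {(x, y). y \<noteq> h(x, a), y \<noteq> h(x, b)}\<close>, so completions correspond to the transversals of \<open>D\<close>,
  that is, to the independent choices of one of two colourings on every connected component.

  Call a pair of coordinates flat if all its mixed differences of the characteristic function of \<open>D\<close>
  vanish. If \<open>D\<close> is split into two unions of components (colours), then a plane meeting both colours
  forces flatness of its two directions in all parallel planes; this follows by induction on the
  Hamming distance to the nearest two-coloured plane. Hence, if \<open>D\<close> is disconnected, the coordinates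
  split into two parts that are flat with respect to each other.

  If every pair is flat, then \<open>D\<close> is linear, \<open>h\<close> is semilinear and \<open>D\<close> has at least \<open>2^(n-1)\<close>
  components. If some pair is not flat, then counting points (components have at least \<open>2^n\<close> points,
  one of them more) shows that there are fewer. If in addition \<open>D\<close> is disconnected, take a minimal
  set \<open>K\<close> of coordinates that contains a non-flat pair and is flat with respect to its complement.
  The sections of \<open>D\<close> over \<open>K\<close> are then connected, so the graph of \<open>h\<close> has only four distinct
  sections over \<open>K\<close> and is given by an equation \<open>\<phi>(x\<^sub>K) = \<gamma>(x\<^sub>L)\<close>, which makes \<open>h\<close> reducible.
\<close>

section \<open>Double codes over a four-element alphabet\<close>

datatype symb = S0 | S1 | S2 | S3

lemma all_symb: "(\<forall>p. P p) \<longleftrightarrow> P S0 \<and> P S1 \<and> P S2 \<and> P S3"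
  by (metis symb.exhaust)

lemma UNIV_symb: "UNIV = {S0, S1, S2, S3}"
  using symb.exhaust by auto

instance symb :: finite
  by standard (simp add: UNIV_symb)

definition two :: "(symb \<Rightarrow> bool) \<Rightarrow> bool" where
  "two P \<longleftrightarrow> card (Collect P) = 2"

lemma two_iff: "two P \<longleftrightarrow>
    (if P S0 then (if P S1 then \<not> P S2 \<and> \<not> P S3 else P S2 \<noteq> P S3)
     else (if P S1 then P S2 \<noteq> P S3 else P S2 \<and> P S3))"
proof -
  have "card (Collect P) = (\<Sum>p\<in>UNIV. of_bool (P p))"
    by simp
  also have "\<dots> = of_bool (P S0) + of_bool (P S1) + of_bool (P S2) + of_bool (P S3)"
    unfolding UNIV_symb by (simp del: sum_of_bool_eq)
  finally show ?thesis unfolding two_def by simp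
qed

lemma two_not: "two P \<Longrightarrow> two (\<lambda>p. \<not> P p)"
  unfolding two_iff by (simp split: if_splits)

lemma two_iff_const: "two P \<Longrightarrow> two (\<lambda>p. P p \<longleftrightarrow> s)"
  by (cases s) (simp_all add: two_not)

lemma two_disjoint:
  assumes "two P" "two Q" "\<And>p. \<not> (P p \<and> Q p)"
  shows "Q p \<longleftrightarrow> \<not> P p"
proof -
  have "\<forall>p. \<not> (P p \<and> Q p)" using assms(3) by blast
  then have "\<forall>p. Q p \<longleftrightarrow> \<not> P p"
    using assms(1,2) unfolding two_iff all_symb by argo
  then show ?thesis by blast
qed

text \<open>Each truth value is taken exactly twice, so the value shared by \<open>s\<close> and
  \<open>t\<close> is used up and every further symbol takes the other one. This is how two layers
  of a line determine the remaining ones.\<close>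

lemma two_third:
  assumes "two P" "s \<noteq> t" "r \<noteq> s" "r \<noteq> t" "P s \<longleftrightarrow> P t"
  shows "P r \<longleftrightarrow> \<not> P s"
proof (cases "P s")
  case True
  have "Collect P = {s, t}"
    by (rule card_seteq[symmetric]) (use True assms in \<open>auto simp: two_def\<close>)
  then show ?thesis using True assms by auto
next
  case False
  have "Collect (\<lambda>p. \<not> P p) = {s, t}"
    by (rule card_seteq[symmetric]) (use False assms two_not[of P] in \<open>auto simp: two_def\<close>)
  then show ?thesis using False assms by auto
qed

lemma two_ex_neq: assumes "two P" obtains t where "t \<noteq> s" "P t"
proof -
  have "\<not> Collect P \<subseteq> {s}"
    using assms card_mono[of "{s}" "Collect P"] by (auto simp: two_def)
  then show ?thesis using that by blast
qed

lemma two_partner: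
  assumes "two P"
  obtains t where "t \<noteq> s" "P t \<longleftrightarrow> P s"
proof -
  have "\<exists>t. t \<noteq> s \<and> (P t \<longleftrightarrow> P s)"
    using two_ex_neq[OF assms, of s] two_ex_neq[OF two_not[OF assms], of s] by metis
  then show ?thesis using that by blast
qed

lemma two_ex: assumes "two P" obtains p where "P p"
  using two_ex_neq[OF assms] by metis

section \<open>Codes, unions of components and flat pairs of directions\<close>

text \<open>Words over a coordinate set \<open>I\<close> are represented by total functions whose
  values outside \<open>I\<close> are made invisible by this predicate. Deleting a coordinate or
  passing to a section then requires no reindexing.\<close>

definition depends_on :: "nat set \<Rightarrow> ((nat \<Rightarrow> symb) \<Rightarrow> 'b) \<Rightarrow> bool" where
  "depends_on I f \<longleftrightarrow> (\<forall>x y. (\<forall>i\<in>I. x i = y i) \<longrightarrow> f x = f y)"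

lemma depends_onD: "depends_on I f \<Longrightarrow> (\<And>i. i \<in> I \<Longrightarrow> x i = y i) \<Longrightarrow> f x = f y"
  unfolding depends_on_def by blast

text \<open>On \<open>I\<close>, the point \<open>y\<close> is turned into \<open>x\<close> by
  rewriting one coordinate at a time; \<open>override_on y x J\<close> is the intermediate point
  once the coordinates in \<open>J\<close> are done.\<close>

lemma constant_if_invariant:
  assumes "finite I" "depends_on I f" "\<And>i x p. i \<in> I \<Longrightarrow> f (x(i := p)) = f x"
  shows "f x = f y"
proof -
  have "J \<subseteq> I \<Longrightarrow> f (override_on y x J) = f y" if "finite J" for J
    using that
  proof (induction J rule: finite_induct)
    case (insert j J)
    have "override_on y x (insert j J) = (override_on y x J)(j := x j)"
      by (auto simp: override_on_def)
    then have "f (override_on y x (insert j J)) = f (override_on y x J)"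
      using insert.prems assms(3) by simp
    then show ?case using insert by simp
  qed (simp add: override_on_def)
  from this[OF assms(1)] have "f (override_on y x I) = f y" by simp
  moreover have "f (override_on y x I) = f x"
    by (rule depends_onD[OF assms(2)]) (simp add: override_on_def)
  ultimately show ?thesis by simp
qed

definition double_code :: "nat set \<Rightarrow> ((nat \<Rightarrow> symb) \<Rightarrow> bool) \<Rightarrow> bool" where
  "double_code I D \<longleftrightarrow> depends_on I D \<and> (\<forall>i\<in>I. \<forall>x. two (\<lambda>p. D (x(i := p))))"

text \<open>Such an \<open>A\<close> is a union of components of the graph on \<open>D\<close> that
  joins points differing in one coordinate of \<open>I\<close>. Connectedness is expressed through
  these unions, without paths.\<close>

definition line_closed ::
    "nat set \<Rightarrow> ((nat \<Rightarrow> symb) \<Rightarrow> bool) \<Rightarrow> ((nat \<Rightarrow> symb) \<Rightarrow> bool) \<Rightarrow> bool" where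
  "line_closed I D A \<longleftrightarrow> depends_on I A \<and> (\<forall>x. A x \<longrightarrow> D x) \<and>
     (\<forall>i\<in>I. \<forall>x p. D x \<longrightarrow> D (x(i := p)) \<longrightarrow> A x = A (x(i := p)))"

definition connected_code :: "nat set \<Rightarrow> ((nat \<Rightarrow> symb) \<Rightarrow> bool) \<Rightarrow> bool" where
  "connected_code I D \<longleftrightarrow> (\<forall>A. line_closed I D A \<longrightarrow> (\<forall>x. \<not> A x) \<or> (\<forall>x. D x \<longrightarrow> A x))"

definition flat :: "((nat \<Rightarrow> symb) \<Rightarrow> bool) \<Rightarrow> nat \<Rightarrow> nat \<Rightarrow> bool" where
  "flat D i j \<longleftrightarrow> (\<forall>x p q. (D x \<longleftrightarrow> D (x(i := p))) \<longleftrightarrow> (D (x(j := q)) \<longleftrightarrow> D (x(i := p, j := q))))"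

definition separated :: "nat set \<Rightarrow> ((nat \<Rightarrow> symb) \<Rightarrow> bool) \<Rightarrow> nat set \<Rightarrow> bool" where
  "separated I D K \<longleftrightarrow> K \<subseteq> I \<and> (\<forall>i\<in>K. \<forall>j\<in>I - K. flat D i j)"

lemma double_code_not: "double_code I D \<Longrightarrow> double_code I (\<lambda>x. \<not> D x)"
  unfolding double_code_def depends_on_def using two_not by meson

lemma flat_not: "flat (\<lambda>x. \<not> D x) i j \<longleftrightarrow> flat D i j"
  unfolding flat_def by blast

lemma flat_sym: "i \<noteq> j \<Longrightarrow> flat D i j \<Longrightarrow> flat D j i"
  unfolding flat_def by (metis fun_upd_twist)

text \<open>In the next three lemmas \<open>d p q\<close> describes a plane of a double code and \<open>c q\<close> is the colour
  (the part of the code) of its line number \<open>q\<close>: lines of different colours have disjoint, hence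
  complementary, traces.\<close>

lemma coloured_plane:
  assumes "\<And>p q q'. c q \<noteq> c q' \<Longrightarrow> d p q \<longleftrightarrow> \<not> d p q'" and "c q0 \<noteq> (c q1 :: bool)"
  shows "(d p q \<longleftrightarrow> d p q') \<longleftrightarrow> (c q \<longleftrightarrow> c q')"
  using assms by metis

lemma coloured_plane_two:
  assumes "\<And>p q q'. c q \<noteq> c q' \<Longrightarrow> d p q \<longleftrightarrow> \<not> d p q'" and "c q0 \<noteq> (c q1 :: bool)"
    and "\<And>p. two (d p)"
  shows "two c"
proof -
  fix p
  have "(d p q \<longleftrightarrow> d p q0) \<longleftrightarrow> (c q \<longleftrightarrow> c q0)" for q
    using assms(1,2) by metis
  then have "c = d p \<or> c = (\<lambda>q. \<not> d p q)" by (cases "d p q0 = c q0") fastforce+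
  then show ?thesis using assms(3) two_not by metis
qed

lemma coloured_cube:
  fixes d :: "symb \<Rightarrow> 'a \<Rightarrow> symb \<Rightarrow> bool" and c :: "symb \<Rightarrow> symb \<Rightarrow> bool"
  assumes c1: "\<And>s p q q'. c s q \<noteq> c s q' \<Longrightarrow> d s p q \<longleftrightarrow> \<not> d s p q'"
    and c2: "\<And>s s' p q. c s q \<noteq> c s' q \<Longrightarrow> d s p q \<longleftrightarrow> \<not> d s' p q"
    and t1: "\<And>s p. two (d s p)" and t2: "\<And>p q. two (\<lambda>s. d s p q)"
    and bi: "c s0 q0 \<noteq> c s0 q0'" and mono: "\<And>q q'. c t q = c t q'"
  shows "\<exists>t'. t' \<noteq> s0 \<and> (\<exists>q q'. c t' q \<noteq> c t' q') \<and> (\<forall>p q. d t' p q \<longleftrightarrow> d s0 p q)"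
proof -
  have two0: "two (c s0)"
    by (rule coloured_plane_two[of "c s0" "d s0", OF _ bi t1]) (use c1 in blast)
  have str0: "(d s0 p q \<longleftrightarrow> d s0 p q') \<longleftrightarrow> (c s0 q \<longleftrightarrow> c s0 q')" for p q q'
    using c1 bi by metis
  \<comment> \<open>In plane \<open>s0\<close>, the lines \<open>q1\<close> and \<open>q2\<close>
    are coloured unlike the one-coloured plane \<open>t\<close>, while \<open>q3\<close> is coloured
    like it.\<close>
  obtain q1 where q1: "c s0 q1 \<noteq> c t q1" using bi mono by metis
  obtain q2 where q2: "q2 \<noteq> q1" "c s0 q2 = c s0 q1" using two_partner[OF two0] by metis
  obtain q3 where q3: "c s0 q3 = c t q3" using bi mono by metis
  \<comment> \<open>Where the colours differ this is \<open>c2\<close>. Elsewhere, plane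
    \<open>t\<close> takes equal values at \<open>q1\<close> and \<open>q2\<close>, which forces its
    value at any third position.\<close>
  have compl: "d t p q \<longleftrightarrow> \<not> d s0 p q" for p q
  proof (cases "c s0 q = c t q")
    case False then show ?thesis using c2 by blast
  next
    case True
    have a: "d t p q1 \<longleftrightarrow> \<not> d s0 p q1" "d t p q2 \<longleftrightarrow> \<not> d s0 p q2"
      using c2 q1 q2 mono by metis+
    have "d s0 p q1 \<longleftrightarrow> d s0 p q2" using str0 q2 by blast
    with a have b: "d t p q1 \<longleftrightarrow> d t p q2" by blast
    have ne: "q \<noteq> q1" "q \<noteq> q2" using True q1 q2 mono by metis+
    have "d t p q \<longleftrightarrow> \<not> d t p q1"
      using two_third[OF t1 q2(1)[symmetric] ne b] .
    moreover have "d s0 p q \<longleftrightarrow> \<not> d s0 p q1"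
      using c1 True q1 mono by metis
    ultimately show ?thesis using a by blast
  qed
  \<comment> \<open>A line of another colour at \<open>q\<close> would be complementary to its
    counterparts in both \<open>s0\<close> and \<open>t\<close>, which are complementary to each
    other.\<close>
  have same: "c u q = c t q" if "c s0 q = c t q" for u q
    using c2[of u q s0] c2[of u q t] compl that by metis
  \<comment> \<open>Across the layers the colour at \<open>q1\<close> also changes, so it takes each
    value twice; hence a second layer \<open>t'\<close> shares the colour of \<open>s0\<close>
    there.\<close>
  have "two (\<lambda>s. c s q1)"
    by (rule coloured_plane_two[of "\<lambda>s. c s q1" "\<lambda>p s. d s p q1" s0 t])
       (use c2 q1 t2 in auto)
  then obtain t' where t': "t' \<noteq> s0" "c t' q1 = c s0 q1" using two_partner by metis
  have bi': "c t' q1 \<noteq> c t' q3" using same[OF q3, of t'] t' q1 mono by metis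
  have two': "two (c t')" by (rule coloured_plane_two[of "c t'" "d t'", OF _ bi' t1]) (use c1 in blast)
  have str': "(d t' p q \<longleftrightarrow> d t' p q') \<longleftrightarrow> (c t' q \<longleftrightarrow> c t' q')" for p q q'
    using c1 bi' by metis
  \<comment> \<open>Both colourings take each value on two lines and they agree at \<open>q3\<close>
    and \<open>q4\<close>, so they agree everywhere.\<close>
  have ceq: "c t' q = c s0 q" for q
  proof (cases "c s0 q = c t q")
    case True then show ?thesis using same by metis
  next
    case False
    obtain q4 where q4: "q4 \<noteq> q3" "c s0 q4 = c s0 q3" using two_partner[OF two0] by metis
    have "c t' q4 = c t' q3" using same q3 q4 mono by metis
    moreover have "q \<noteq> q3" "q \<noteq> q4" using False q3 q4 mono by metis+
    ultimately have "c t' q \<longleftrightarrow> \<not> c t' q3" using two_third[OF two'] q4 by metis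
    then show ?thesis using False q3 same mono by metis
  qed
  have "d t' p q1 \<longleftrightarrow> d s0 p q1" for p
    using c2[of t' q1 t p] c2[of s0 q1 t p] t' q1 by blast
  then have "d t' p q \<longleftrightarrow> d s0 p q" for p q
    using str0[of p q q1] str'[of p q q1] ceq by blast
  then show ?thesis using t' bi' by blast
qed

section \<open>Disconnected codes are separated\<close>

definition hdist :: "nat set \<Rightarrow> (nat \<Rightarrow> symb) \<Rightarrow> (nat \<Rightarrow> symb) \<Rightarrow> nat" where
  "hdist J x z = card {k\<in>J. x k \<noteq> z k}"

lemma hdist_upd:
  assumes "finite J" "l \<in> J" "x l \<noteq> z l"
  shows "hdist J x (z(l := x l)) = hdist J x z - 1"
    and "hdist J (x(l := t)) (z(l := t)) = hdist J x z - 1"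
    and "hdist J x y \<le> Suc (hdist J (x(l := t)) y)"
  unfolding hdist_def
proof -
  have "{k\<in>J. x k \<noteq> (z(l := x l)) k} = {k\<in>J. x k \<noteq> z k} - {l}"
    "{k\<in>J. (x(l := t)) k \<noteq> (z(l := t)) k} = {k\<in>J. x k \<noteq> z k} - {l}"
    using assms by auto
  moreover have "card ({k\<in>J. x k \<noteq> z k} - {l}) = card {k\<in>J. x k \<noteq> z k} - 1"
    using assms by simp
  ultimately show "card {k\<in>J. x k \<noteq> (z(l := x l)) k} = card {k\<in>J. x k \<noteq> z k} - 1"
    "card {k\<in>J. (x(l := t)) k \<noteq> (z(l := t)) k} = card {k\<in>J. x k \<noteq> z k} - 1" by simp_all
  have "card {k\<in>J. x k \<noteq> y k} \<le> card (insert l {k\<in>J. (x(l := t)) k \<noteq> y k})"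
    by (rule card_mono) (use assms in auto)
  also have "\<dots> \<le> Suc (card {k\<in>J. (x(l := t)) k \<noteq> y k})"
    by (rule card_insert_le_m1[THEN order_trans]) auto
  finally show "card {k\<in>J. x k \<noteq> y k} \<le> Suc (card {k\<in>J. (x(l := t)) k \<noteq> y k})" .
qed

section \<open>Colours of lines and two-coloured planes\<close>

context
  fixes I :: "nat set" and D A :: "(nat \<Rightarrow> symb) \<Rightarrow> bool"
  assumes fin: "finite I" and dc: "double_code I D" and lc: "line_closed I D A"
begin

text \<open>The points of \<open>D\<close> on one line lie all in \<open>A\<close> or all outside
  it, so the line as a whole has a colour. Asking for a point of \<open>A\<close> on the line makes
  the colour available at points outside \<open>D\<close> too.\<close>

definition colour :: "nat \<Rightarrow> (nat \<Rightarrow> symb) \<Rightarrow> bool" where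
  "colour i x \<longleftrightarrow> (\<exists>p. A (x(i := p)))"

lemma two_line: "i \<in> I \<Longrightarrow> two (\<lambda>p. D (x(i := p)))"
  using dc unfolding double_code_def by blast

lemma colour_upd [simp]: "colour i (x(i := p)) = colour i x"
  by (simp add: colour_def)

lemma colour_eq:
  assumes "i \<in> I" "D x" shows "A x \<longleftrightarrow> colour i x"
proof
  show "A x \<Longrightarrow> colour i x" unfolding colour_def by (metis fun_upd_triv)
  assume "colour i x"
  then obtain p where "A (x(i := p))" unfolding colour_def by blast
  then show "A x" using lc assms unfolding line_closed_def by blast
qed

lemma colour_depends: "depends_on I (colour i)"
  unfolding depends_on_def
proof (intro allI impI)
  fix x y :: "nat \<Rightarrow> symb" assume "\<forall>k\<in>I. x k = y k"
  then have "A (x(i := p)) = A (y(i := p))" for p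
    using lc unfolding line_closed_def by (intro depends_onD[of I A]) auto
  then show "colour i x = colour i y" unfolding colour_def by blast
qed

text \<open>A position common to both traces would give two points of \<open>D\<close> joined in
  direction \<open>j\<close>, hence lines of one colour. So the traces are disjoint pairs among four
  positions.\<close>

lemma colour_neq_complement:
  assumes "i \<in> I" "j \<in> I" "i \<noteq> j" "colour i x \<noteq> colour i (x(j := q))"
  shows "D (x(i := p)) \<longleftrightarrow> \<not> D (x(j := q, i := p))"
proof -
  have "\<not> (D (x(j := q, i := p)) \<and> D (x(i := p)))" for p
  proof
    assume a: "D (x(j := q, i := p)) \<and> D (x(i := p))"
    have "x(j := q, i := p) = (x(i := p))(j := q)" using assms(3) by (simp add: fun_upd_twist)
    then have "A (x(i := p)) = A (x(j := q, i := p))"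
      using a lc assms(2) unfolding line_closed_def by metis
    then show False using colour_eq[OF assms(1)] a assms(4) by simp
  qed
  from two_disjoint[OF two_line[OF assms(1)] two_line[OF assms(1)] this]
  show ?thesis .
qed

lemma colour_neq_complement':
  assumes "i \<in> I" "j \<in> I" "i \<noteq> j" "colour i (x(j := q)) \<noteq> colour i (x(j := q'))"
  shows "D (x(j := q, i := p)) \<longleftrightarrow> \<not> D (x(j := q', i := p))"
  using colour_neq_complement[OF assms(1-3), of "x(j := q)" q' p] assms(4) by simp

definition bichromatic :: "nat \<Rightarrow> nat \<Rightarrow> (nat \<Rightarrow> symb) \<Rightarrow> bool" where
  "bichromatic i j x \<longleftrightarrow> (\<exists>q q'. colour i (x(j := q)) \<noteq> colour i (x(j := q')))"

lemma bichromatic_plane: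
  assumes "i \<in> I" "j \<in> I" "i \<noteq> j" "bichromatic i j x"
  shows "(D (x(j := q, i := p)) \<longleftrightarrow> D (x(j := q', i := p))) \<longleftrightarrow>
    (colour i (x(j := q)) \<longleftrightarrow> colour i (x(j := q')))"
  using assms(4) colour_neq_complement'[OF assms(1-3), of x] unfolding bichromatic_def by metis

text \<open>This is \<open>coloured_cube\<close> for the three-dimensional face in directions
  \<open>l\<close>, \<open>i\<close>, \<open>j\<close>, with the layers taken in direction
  \<open>l\<close>.\<close>

lemma bichromatic_neighbour:
  assumes i: "i \<in> I" and j: "j \<in> I" and l: "l \<in> I" and ne: "i \<noteq> j" "l \<noteq> i" "l \<noteq> j"
    and bi: "bichromatic i j z" and mono: "\<not> bichromatic i j (z(l := t))"
  shows "\<exists>t'. t' \<noteq> z l \<and> bichromatic i j (z(l := t')) \<and>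
      (\<forall>p q. D (z(l := t', j := q, i := p)) \<longleftrightarrow> D (z(j := q, i := p)))"
proof -
  define d where "d s p q = D (z(l := s, j := q, i := p))" for s p q
  define c where "c s q = colour i (z(l := s, j := q))" for s q
  have tw: "z(l := s, j := q) = z(j := q, l := s)" for s q
    using ne by (simp add: fun_upd_twist)
  have tw2: "z(l := s, j := q, i := p) = z(l := s, i := p, j := q)" for s q p
    using ne by (simp add: fun_upd_twist)
  have tw3: "z(l := s, j := q, i := p) = z(j := q, i := p, l := s)" for s q p
    using ne by (auto simp: fun_eq_iff)
  have d0: "d (z l) p q = D (z(j := q, i := p))" for p q by (simp add: d_def)
  have c1: "c s q \<noteq> c s q' \<Longrightarrow> d s p q \<longleftrightarrow> \<not> d s p q'" for s p q q'
    unfolding c_def d_def using colour_neq_complement'[OF i j ne(1)] by blast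
  have c2: "c s q \<noteq> c s' q \<Longrightarrow> d s p q \<longleftrightarrow> \<not> d s' p q" for s s' p q
    unfolding c_def d_def tw using colour_neq_complement'[OF i l ne(2)[symmetric]] by blast
  have t1: "two (d s p)" for s p
    unfolding d_def tw2 using two_line[OF j] by blast
  have t2: "two (\<lambda>s. d s p q)" for p q
    unfolding d_def tw3 using two_line[OF l] by blast
  obtain q0 q0' where b: "c (z l) q0 \<noteq> c (z l) q0'"
    using bi unfolding bichromatic_def c_def by auto
  have m: "c t q = c t q'" for q q'
    using mono unfolding bichromatic_def c_def by blast
  show ?thesis
    using coloured_cube[of c d, OF c1 c2 t1 t2 b m] unfolding d0 bichromatic_def unfolding d_def c_def by blast
qed

text \<open>Induction on the Hamming distance to a nearest bichromatic plane: crossing one coordinate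
  on a shortest path complements the plane.\<close>

lemma plane_by_distance:
  assumes i: "i \<in> I" and j: "j \<in> I" and ne: "i \<noteq> j" and "bichromatic i j z"
    and "hdist (I - {i, j}) x z = n"
    and "\<And>z'. bichromatic i j z' \<Longrightarrow> n \<le> hdist (I - {i, j}) x z'"
  shows "D (x(j := q, i := p)) \<longleftrightarrow> (D (z(j := q, i := p)) \<longleftrightarrow> even n)"
  using assms(4-)
proof (induction n arbitrary: x z)
  case 0
  then have "\<forall>k\<in>I - {i, j}. x k = z k" using fin by (auto simp: hdist_def)
  then have "D (x(j := q, i := p)) = D (z(j := q, i := p))"
    using dc unfolding double_code_def by (intro depends_onD[of I D]) auto
  then show ?case by (simp only: even_zero simp_thms)
next
  case (Suc n)
  let ?J = "I - {i, j}"
  have finJ: "finite ?J" using fin by simp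
  have "{k\<in>?J. x k \<noteq> z k} \<noteq> {}" using Suc.prems(2) unfolding hdist_def by (metis card.empty nat.distinct(1))
  then obtain l where l: "l \<in> ?J" "x l \<noteq> z l" by blast
  \<comment> \<open>Replacing \<open>z l\<close> by \<open>x l\<close> brings the plane closer to
    \<open>x\<close>, so minimality of the distance rules out two colours.\<close>
  have nb: "\<not> bichromatic i j (z(l := x l))"
  proof
    assume "bichromatic i j (z(l := x l))"
    from Suc.prems(3)[OF this] show False
      using Suc.prems(2) hdist_upd(1)[of ?J l x z, OF finJ l] by linarith
  qed
  have lI: "l \<in> I" "l \<noteq> i" "l \<noteq> j" using l by auto
  obtain t' where t': "t' \<noteq> z l" "bichromatic i j (z(l := t'))"
    "\<And>p q. D (z(l := t', j := q, i := p)) \<longleftrightarrow> D (z(j := q, i := p))"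
    using bichromatic_neighbour[OF i j lI(1) ne lI(2,3) Suc.prems(1) nb] by blast
  have tx: "t' \<noteq> x l" using t' nb by auto
  have IH: "D (x(l := t, j := q, i := p)) \<longleftrightarrow> (D (z(l := t, j := q, i := p)) \<longleftrightarrow> even n)"
    if "bichromatic i j (z(l := t))" for t
  proof (rule Suc.IH[OF that])
    show "hdist ?J (x(l := t)) (z(l := t)) = n"
      using hdist_upd(2)[of ?J l x z, OF finJ l] Suc.prems(2) by simp
    show "n \<le> hdist ?J (x(l := t)) z'" if "bichromatic i j z'" for z'
      using hdist_upd(3)[of ?J l x z z' t, OF finJ l] Suc.prems(3)[OF that] by linarith
  qed
  \<comment> \<open>The layers \<open>z l\<close> and \<open>t'\<close> of \<open>x\<close> are at
    distance \<open>n\<close> from bichromatic planes with equal traces, so \<open>D\<close> takes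
    the same value in both. The layer \<open>x l\<close> is a third one and takes the opposite
    value.\<close>
  have a: "D (x(l := z l, j := q, i := p)) \<longleftrightarrow> (D (z(j := q, i := p)) \<longleftrightarrow> even n)"
    using IH[of "z l"] Suc.prems(1) by simp
  have b: "D (x(l := t', j := q, i := p)) \<longleftrightarrow> (D (z(j := q, i := p)) \<longleftrightarrow> even n)"
    using IH[of t'] t' by simp
  have tw: "x(l := s, j := q, i := p) = x(j := q, i := p, l := s)" for s
    using lI by (auto simp: fun_eq_iff)
  have "D (x(j := q, i := p, l := x l)) \<longleftrightarrow> \<not> D (x(j := q, i := p, l := z l))"
    by (rule two_third[OF two_line[OF lI(1)] t'(1)[symmetric] l(2) tx[symmetric]])
       (use a b tw in simp)
  then have "D (x(j := q, i := p)) \<longleftrightarrow> \<not> D (x(l := z l, j := q, i := p))"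
    using tw by (metis fun_upd_triv)
  then show ?case using a by (simp only: even_Suc) blast
qed

text \<open>Every plane in directions \<open>i\<close>, \<open>j\<close> is a copy or the complement
  of a nearest bichromatic plane. In the latter, whether \<open>D\<close> agrees at two positions
  depends only on the colours of the two \<open>i\<close>-lines, and complementing preserves such
  comparisons.\<close>

lemma flat_if_bichromatic:
  assumes i: "i \<in> I" and j: "j \<in> I" and ne: "i \<noteq> j" and bi: "bichromatic i j x0"
  shows "flat D i j"
proof -
  have key: "(D (x(j := q, i := p)) \<longleftrightarrow> D (x(j := q', i := p))) \<longleftrightarrow>
    (D (x(j := q, i := p')) \<longleftrightarrow> D (x(j := q', i := p')))" for x p p' q q'
  proof -
    obtain z where z: "bichromatic i j z"
      and min: "\<And>z'. bichromatic i j z' \<Longrightarrow>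
        hdist (I - {i, j}) x z \<le> hdist (I - {i, j}) x z'"
      using ex_has_least_nat[of "bichromatic i j" x0 "\<lambda>z. hdist (I - {i, j}) x z", OF bi]
      that by blast
    have "D (x(j := q, i := p)) \<longleftrightarrow> (D (z(j := q, i := p)) \<longleftrightarrow>
        even (hdist (I - {i, j}) x z))" for p q
      by (rule plane_by_distance[OF i j ne z refl min])
    then show ?thesis
      using bichromatic_plane[OF i j ne z, of q p q'] bichromatic_plane[OF i j ne z, of q p' q']
      by metis
  qed
  show ?thesis unfolding flat_def
  proof (intro allI)
    fix x :: "nat \<Rightarrow> symb" and p q
    have "x(i := p, j := q) = x(j := q, i := p)" using ne by (simp add: fun_upd_twist)
    moreover have "x(j := x j, i := x i) = x" "x(j := x j, i := p) = x(i := p)"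
      "x(j := q, i := x i) = x(j := q)" using ne by auto
    ultimately show "(D x \<longleftrightarrow> D (x(i := p))) \<longleftrightarrow> (D (x(j := q)) \<longleftrightarrow> D (x(i := p, j := q)))"
      using key[of x "x j" "x i" q p] by metis
  qed
qed

text \<open>Otherwise \<open>k\<close>-colours would be invariant in direction \<open>j\<close>. A
  point of \<open>D\<close> reached from \<open>x\<close> by moves in directions \<open>i\<close>,
  \<open>j\<close>, \<open>k\<close> then has the colour of \<open>x\<close> when judged by
  \<open>k\<close>-lines, but that of \<open>x(j := q)\<close> when judged by
  \<open>i\<close>-lines.\<close>

lemma bichromatic_transfer:
  assumes i: "i \<in> I" and k: "k \<in> I" and ne: "i \<noteq> j" "k \<noteq> j" "k \<noteq> i"
    and indep: "\<And>x r. colour i (x(k := r)) = colour i x"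
    and dep: "colour i x \<noteq> colour i (x(j := q))"
  shows "\<exists>y. bichromatic k j y"
proof (rule ccontr)
  assume "\<nexists>y. bichromatic k j y"
  then have mono: "colour k (y(j := q)) = colour k y" for y q
    unfolding bichromatic_def by (metis fun_upd_triv)
  obtain p where p: "D (x(i := p))" using two_ex[OF two_line[OF i]] .
  obtain r where r: "D (x(i := p, j := q, k := r))" using two_ex[OF two_line[OF k]] .
  have "A (x(i := p, j := q, k := r)) = colour k (x(i := p))"
    using colour_eq[OF k r] mono by simp
  also have "\<dots> = colour i x"
    using colour_eq[OF k p] colour_eq[OF i p] by simp
  finally have "A (x(i := p, j := q, k := r)) = colour i x" .
  moreover have "A (x(i := p, j := q, k := r)) = colour i (x(j := q))"
  proof -
    have "x(i := p, j := q) = x(j := q, i := p)" using ne by (simp add: fun_upd_twist)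
    then show ?thesis using colour_eq[OF i r] indep by simp
  qed
  ultimately show False using dep by blast
qed

lemma separated_if_line_closed:
  assumes "A x1" "D x2" "\<not> A x2" and ne: "i \<in> I"
  shows "\<exists>K. K \<noteq> {} \<and> K \<noteq> I \<and> separated I D K"
proof -
  \<comment> \<open>\<open>K\<close> collects the directions that never change the colour of an
    \<open>i\<close>-line. A direction outside \<open>K\<close> yields a bichromatic plane with
    \<open>i\<close>, and by \<open>bichromatic_transfer\<close> one with every other member of
    \<open>K\<close>.\<close>
  define K where "K = {k\<in>I. \<forall>x r. colour i (x(k := r)) = colour i x}"
  have "i \<in> K" using ne by (simp add: K_def)
  have "K \<noteq> I"
  proof
    assume "K = I"
    have "colour i x1 = colour i x2"
      by (rule constant_if_invariant[of I "colour i", OF fin colour_depends])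
         (use \<open>K = I\<close> in \<open>auto simp: K_def\<close>)
    then show False using assms colour_eq[OF ne] lc unfolding line_closed_def by blast
  qed
  moreover have "flat D k j" if k: "k \<in> K" and j: "j \<in> I - K" for k j
  proof -
    obtain x q where dep: "colour i x \<noteq> colour i (x(j := q))" using j unfolding K_def by auto
    have "j \<noteq> k" "j \<noteq> i" using j k \<open>i \<in> K\<close> by auto
    have "\<exists>y. bichromatic k j y"
    proof (cases "k = i")
      case True then show ?thesis using dep unfolding bichromatic_def by (metis fun_upd_triv)
    next
      case False
      show ?thesis
        by (rule bichromatic_transfer[OF ne _ _ _ False _ dep])
           (use k \<open>j \<noteq> k\<close> \<open>j \<noteq> i\<close> in \<open>auto simp: K_def\<close>)
    qed
    then show ?thesis
      using flat_if_bichromatic[of k j] j k \<open>j \<noteq> k\<close> unfolding K_def by blast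
  qed
  moreover have "K \<subseteq> I" by (auto simp: K_def)
  ultimately show ?thesis using \<open>i \<in> K\<close> unfolding separated_def by blast
qed

end

lemma separated_if_disconnected:
  assumes "finite I" "I \<noteq> {}" "double_code I D" "\<not> connected_code I D"
  shows "\<exists>K. K \<noteq> {} \<and> K \<noteq> I \<and> separated I D K"
  using assms separated_if_line_closed unfolding connected_code_def by (metis ex_in_conv)

section \<open>Splitting the graph of a quasigroup\<close>

lemma override_upd_in: "i \<in> K \<Longrightarrow> override_on v (u(i := p)) K = (override_on v u K)(i := p)"
  by (auto simp: override_on_def)

lemma override_upd_out: "i \<notin> K \<Longrightarrow> override_on (v(i := p)) u K = (override_on v u K)(i := p)"
  by (auto simp: override_on_def)

lemma override_same [simp]: "override_on x x K = x"
  by (auto simp: override_on_def)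

lemma depends_on_override:
  "depends_on N f \<Longrightarrow> depends_on K (\<lambda>u. f (override_on v u K))"
  "depends_on N f \<Longrightarrow> depends_on (N - K) (\<lambda>v. f (override_on v u K))"
  unfolding depends_on_def by (auto simp: override_on_def)

text \<open>\<open>override_on v u K\<close> takes the coordinates in \<open>K\<close> from
  \<open>u\<close> and the others from \<open>v\<close>. Modulo 2, \<open>D\<close> is a function of
  the first plus a function of the second; this is phrased by differences in \<open>u\<close> that
  do not depend on \<open>v\<close>.\<close>

lemma separated_additive:
  assumes fin: "finite I" and dep: "depends_on I D" and sep: "separated I D K"
  shows "(D (override_on v u K) \<longleftrightarrow> D (override_on v u' K)) \<longleftrightarrow>
    (D (override_on v' u K) \<longleftrightarrow> D (override_on v' u' K))"
proof -
  have KI: "K \<subseteq> I" and fl: "\<And>i j. i \<in> K \<Longrightarrow> j \<in> I - K \<Longrightarrow> flat D i j"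
    using sep unfolding separated_def by auto
  \<comment> \<open>First \<open>u\<close> varies: by flatness, the effect of a single step in an
    outer direction \<open>j\<close> is the same for all inner parts. Then \<open>v\<close> is
    varied one coordinate at a time.\<close>
  have step: "(D (override_on v u K) = D ((override_on v u K)(j := q))) =
      (D (override_on v u' K) = D ((override_on v u' K)(j := q)))" if j: "j \<in> I - K" for u u' v j q
  proof (rule constant_if_invariant[where I = K and x = u and y = u'
        and f = "\<lambda>u. D (override_on v u K) = D ((override_on v u K)(j := q))"])
    show "finite K" using KI fin finite_subset by blast
    show "depends_on K (\<lambda>u. D (override_on v u K) = D ((override_on v u K)(j := q)))"
      unfolding depends_on_def by (auto simp: override_on_def cong: if_cong)
    show "(D (override_on v (x(i := p)) K) = D ((override_on v (x(i := p)) K)(j := q))) =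
      (D (override_on v x K) = D ((override_on v x K)(j := q)))" if "i \<in> K" for i x p
      using fl[OF that j] unfolding override_upd_in[OF that] flat_def by blast
  qed
  show ?thesis
  proof (rule constant_if_invariant[where I = "I - K" and x = v and y = v'
        and f = "\<lambda>v. D (override_on v u K) = D (override_on v u' K)"])
    show "depends_on (I - K) (\<lambda>v. D (override_on v u K) = D (override_on v u' K))"
      using depends_on_override(2)[OF dep] unfolding depends_on_def by metis
    show "(D (override_on (x(i := p)) u K) = D (override_on (x(i := p)) u' K)) =
      (D (override_on x u K) = D (override_on x u' K))" if "i \<in> I - K" for i x p
    proof -
      have "i \<notin> K" using that by blast
      then show ?thesis
        using step[OF that, of x u p u'] unfolding override_upd_out[OF \<open>i \<notin> K\<close>] by blast
    qed
  qed (use fin in simp)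
qed

lemma double_code_section:
  assumes "double_code I D" "K \<subseteq> I"
  shows "double_code K (\<lambda>u. D (override_on v u K))"
  unfolding double_code_def
proof (intro conjI ballI allI)
  show "depends_on K (\<lambda>u. D (override_on v u K))"
    using assms depends_on_override(1) unfolding double_code_def by blast
  fix i x assume i: "i \<in> K"
  then show "two (\<lambda>p. D (override_on v (x(i := p)) K))"
    using assms unfolding override_upd_in[OF i] double_code_def by blast
qed

text \<open>By additivity, comparing \<open>D\<close> at two points that agree off \<open>K\<close>
  does not depend on their values off \<open>K\<close>, so a single section decides flatness within
  \<open>K\<close>.\<close>

lemma flat_of_section:
  assumes fin: "finite I" and dep: "depends_on I D" and sep: "separated I D K"
    and "i \<in> K" "j \<in> K" and fl: "flat (\<lambda>u. D (override_on v u K)) i j"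
  shows "flat D i j"
  unfolding flat_def
proof (intro allI)
  fix x p q
  have *: "(D y \<longleftrightarrow> D y') \<longleftrightarrow> (D (override_on v y K) \<longleftrightarrow> D (override_on v y' K))"
    if "\<And>k. k \<notin> K \<Longrightarrow> y k = y' k" for y y'
  proof -
    have "override_on y y' K = y'" using that by (auto simp: override_on_def)
    then show ?thesis using separated_additive[OF fin dep sep, of y y y' v] by simp
  qed
  have "(D x \<longleftrightarrow> D (x(i := p))) \<longleftrightarrow> (D (override_on v x K) \<longleftrightarrow> D (override_on v (x(i := p)) K))"
    "(D (x(j := q)) \<longleftrightarrow> D (x(i := p, j := q))) \<longleftrightarrow>
      (D (override_on v (x(j := q)) K) \<longleftrightarrow> D (override_on v (x(i := p, j := q)) K))"
    by (rule *; use assms(4,5) in auto)+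
  then show "(D x \<longleftrightarrow> D (x(i := p))) \<longleftrightarrow> (D (x(j := q)) \<longleftrightarrow> D (x(i := p, j := q)))"
    using fl unfolding flat_def by blast
qed

lemma separated_compl:
  assumes "separated I D K" shows "separated I D (I - K)"
proof -
  have "flat D i j" if "i \<in> I - K" "j \<in> I - (I - K)" for i j
  proof (rule flat_sym)
    show "j \<noteq> i" using that by blast
    show "flat D j i" using assms that unfolding separated_def by blast
  qed
  then show ?thesis unfolding separated_def by blast
qed

text \<open>\<open>K\<close> has least size among the separated sets containing \<open>i0\<close>. A
  disconnected section would cut \<open>K\<close> into two parts flat with respect to each other,
  and this flatness lifts from the section to \<open>D\<close>. The parameter \<open>s\<close>
  covers the complements of sections as well.\<close>

lemma prime_component:
  assumes fin: "finite I" and dc: "double_code I D" and disc: "\<not> connected_code I D"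
    and i0: "i0 \<in> I" and j0: "j0 \<in> I" and nf: "\<not> flat D i0 j0"
  obtains K where "separated I D K" "i0 \<in> K" "j0 \<in> K" "K \<noteq> I"
    "\<And>v s. connected_code K (\<lambda>u. D (override_on v u K) \<longleftrightarrow> s)"
proof -
  let ?P = "\<lambda>K. separated I D K \<and> i0 \<in> K"
  have "?P I" using i0 unfolding separated_def by auto
  then obtain K where K: "?P K" and min: "\<And>K'. ?P K' \<Longrightarrow> card K \<le> card K'"
    using ex_has_least_nat[of ?P I card] by metis
  have KI: "K \<subseteq> I" and finK: "finite K"
    using K fin finite_subset unfolding separated_def by auto
  \<comment> \<open>If both pieces were nonempty, the one containing \<open>i0\<close> would be a
    smaller candidate than \<open>K\<close>.\<close>
  have split: "K' = {} \<or> K' = K" if "K' \<subseteq> K" "separated I D K'" "separated I D (K - K')" for K'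
  proof (rule ccontr)
    assume ne: "\<not> (K' = {} \<or> K' = K)"
    have "card K' < card K" "card (K - K') < card K"
      using ne that(1) finK by (auto intro!: psubset_card_mono)
    then show False using min[of K'] min[of "K - K'"] that K by fastforce
  qed
  have "j0 \<in> K" using K nf j0 unfolding separated_def by blast
  moreover have "K \<noteq> I"
  proof
    assume "K = I"
    obtain K1 where K1: "K1 \<noteq> {}" "K1 \<noteq> I" "separated I D K1"
      using separated_if_disconnected[OF fin _ dc disc] i0 by blast
    then show False
      using split[of K1] separated_compl[OF K1(3)] \<open>K = I\<close> unfolding separated_def by blast
  qed
  moreover have "connected_code K (\<lambda>u. D (override_on v u K) \<longleftrightarrow> s)" for v s
  proof (rule ccontr)
    let ?E = "\<lambda>u. D (override_on v u K) \<longleftrightarrow> s"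
    assume nc: "\<not> connected_code K ?E"
    have dcE: "double_code K ?E"
      using double_code_section[OF dc KI, of v] double_code_not[OF double_code_section[OF dc KI, of v]]
      by (cases s) simp_all
    have "K \<noteq> {}" using K by blast
    from separated_if_disconnected[OF finK this dcE nc]
    obtain K' where K': "K' \<noteq> {}" "K' \<noteq> K" "separated K ?E K'" by blast
    have depD: "depends_on I D" using dc unfolding double_code_def by blast
    have flE: "flat D i j" if "flat ?E i j" "i \<in> K" "j \<in> K" for i j
    proof (rule flat_of_section[OF fin depD conjunct1[OF K] that(2,3)])
      show "flat (\<lambda>u. D (override_on v u K)) i j"
        using that(1) flat_not[of "\<lambda>u. D (override_on v u K)"] by (cases s) simp_all
    qed
    have sepD: "separated I D L" if L: "separated K ?E L" for L
      unfolding separated_def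
    proof (intro conjI ballI)
      show "L \<subseteq> I" using L KI unfolding separated_def by blast
      fix i j assume ij: "i \<in> L" "j \<in> I - L"
      have "i \<in> K" using L ij unfolding separated_def by blast
      show "flat D i j"
      proof (cases "j \<in> K")
        case True
        then show ?thesis using flE \<open>i \<in> K\<close> L ij unfolding separated_def by blast
      next
        case False
        then show ?thesis using K ij \<open>i \<in> K\<close> unfolding separated_def by blast
      qed
    qed
    show False
      using split[of K'] K' sepD[OF K'(3)] sepD[OF separated_compl[OF K'(3)]]
      unfolding separated_def by blast
  qed
  ultimately show ?thesis using that K by blast
qed

section \<open>Transversals, MDS codes and their shadows\<close>

text \<open>\<open>U\<close> is a colour class of a proper 2-colouring of the adjacency graph of
  \<open>E\<close>; when \<open>E\<close> is a double code, it picks one of the two points on every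
  line.\<close>

definition transversal ::
    "nat set \<Rightarrow> ((nat \<Rightarrow> symb) \<Rightarrow> bool) \<Rightarrow> ((nat \<Rightarrow> symb) \<Rightarrow> bool) \<Rightarrow> bool" where
  "transversal K E U \<longleftrightarrow> depends_on K U \<and> (\<forall>x. U x \<longrightarrow> E x) \<and>
     (\<forall>i\<in>K. \<forall>x p. E x \<longrightarrow> E (x(i := p)) \<longrightarrow> p \<noteq> x i \<longrightarrow> U x \<noteq> U (x(i := p)))"

text \<open>Passing to another point of \<open>E\<close> on a line flips both transversals, so
  whether they agree does not change.\<close>

lemma line_closed_transversals:
  assumes "depends_on K E" "transversal K E U" "transversal K E U'"
  shows "line_closed K E (\<lambda>x. E x \<and> (U x \<longleftrightarrow> U' x))"
  unfolding line_closed_def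
proof (intro conjI ballI allI impI)
  show "depends_on K (\<lambda>x. E x \<and> (U x \<longleftrightarrow> U' x))"
    using assms unfolding transversal_def depends_on_def by metis
  fix i x p assume a: "i \<in> K" "E x" "E (x(i := p))"
  show "(E x \<and> (U x \<longleftrightarrow> U' x)) = (E (x(i := p)) \<and> (U (x(i := p)) \<longleftrightarrow> U' (x(i := p))))"
  proof (cases "p = x i")
    case True then show ?thesis by simp
  next
    case False
    then have "U x \<noteq> U (x(i := p))" "U' x \<noteq> U' (x(i := p))"
      using a assms(2,3) unfolding transversal_def by blast+
    then show ?thesis using a by blast
  qed
qed blast

lemma transversals_of_connected:
  assumes "connected_code K E" "depends_on K E" "transversal K E U" "transversal K E U'"
  shows "(\<forall>x. U' x \<longleftrightarrow> U x) \<or> (\<forall>x. U' x \<longleftrightarrow> E x \<and> \<not> U x)"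
proof -
  have "\<forall>x. U x \<longrightarrow> E x" "\<forall>x. U' x \<longrightarrow> E x" using assms unfolding transversal_def by blast+
  moreover have "(\<forall>x. \<not> (E x \<and> (U x \<longleftrightarrow> U' x))) \<or> (\<forall>x. E x \<longrightarrow> E x \<and> (U x \<longleftrightarrow> U' x))"
    using assms(1) line_closed_transversals[OF assms(2-4)] unfolding connected_code_def by blast
  ultimately show ?thesis by meson
qed

definition single_code :: "nat set \<Rightarrow> ((nat \<Rightarrow> symb) \<Rightarrow> bool) \<Rightarrow> bool" where
  "single_code N M \<longleftrightarrow> depends_on N M \<and> (\<forall>i\<in>N. \<forall>x. \<exists>!p. M (x(i := p)))"

text \<open>The words of \<open>M\<close> whose \<open>l\<close>-coordinate lies in
  \<open>T\<close>, projected along \<open>l\<close>. With \<open>M\<close> the graph of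
  \<open>h\<close>, \<open>l\<close> the last argument and \<open>T\<close> the two symbols other
  than \<open>a\<close> and \<open>b\<close>, this is the double code of the overview.\<close>

definition shadow ::
    "((nat \<Rightarrow> symb) \<Rightarrow> bool) \<Rightarrow> nat \<Rightarrow> (symb \<Rightarrow> bool) \<Rightarrow> (nat \<Rightarrow> symb) \<Rightarrow> bool" where
  "shadow M l T x \<longleftrightarrow> (\<exists>t. T t \<and> M (x(l := t)))"

lemma shadow_upd [simp]: "shadow M l T (x(l := t)) = shadow M l T x"
  by (simp add: shadow_def)

lemma shadow_iff:
  assumes "single_code N M" "l \<in> N" "M x"
  shows "shadow M l T x \<longleftrightarrow> T (x l)"
proof -
  have "\<exists>!p. M (x(l := p))" using assms unfolding single_code_def by blast
  moreover have "M (x(l := x l))" using assms(3) by simp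
  ultimately have "\<And>t. M (x(l := t)) \<longleftrightarrow> t = x l" by blast
  then show ?thesis unfolding shadow_def by auto
qed

lemma shadow_not:
  assumes "single_code N M" "l \<in> N"
  shows "\<not> shadow M l T x \<longleftrightarrow> shadow M l (\<lambda>t. \<not> T t) x"
proof -
  have "\<exists>!p. M (x(l := p))" using assms unfolding single_code_def by blast
  then show ?thesis unfolding shadow_def by blast
qed

lemma double_code_shadow:
  assumes sc: "single_code N M" and l: "l \<in> N" and T: "two T"
  shows "double_code (N - {l}) (shadow M l T)"
  unfolding double_code_def
proof (intro conjI ballI allI)
  show "depends_on (N - {l}) (shadow M l T)"
    unfolding depends_on_def
  proof (intro allI impI)
    fix x y :: "nat \<Rightarrow> symb" assume "\<forall>i\<in>N - {l}. x i = y i"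
    then have "M (x(l := t)) = M (y(l := t))" for t
      using sc unfolding single_code_def by (intro depends_onD[of N M]) auto
    then show "shadow M l T x = shadow M l T y" unfolding shadow_def by simp
  qed
  fix i and x :: "nat \<Rightarrow> symb" assume i: "i \<in> N - {l}"
  have tw: "x(i := p, l := t) = x(l := t, i := p)" for p t
    using i by (auto simp: fun_upd_twist)
  have ex: "\<exists>!p. M (x(i := p, l := t))" for t
    unfolding tw using sc i unfolding single_code_def by blast
  have un: "M (x(i := p, l := t)) \<Longrightarrow> M (x(i := p, l := t')) \<Longrightarrow> t = t'" for p t t'
    using sc l unfolding single_code_def by blast
  define g where "g t = (THE p. M (x(i := p, l := t)))" for t
  have g: "M (x(i := p, l := t)) \<longleftrightarrow> p = g t" for p t
    unfolding g_def using ex[of t] theI'[OF ex[of t]] by blast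
  have "inj_on g (Collect T)" using un unfolding g by (auto intro: inj_onI)
  moreover have "Collect (\<lambda>p. shadow M l T (x(i := p))) = g ` Collect T"
    unfolding shadow_def g by auto
  ultimately show "two (\<lambda>p. shadow M l T (x(i := p)))"
    using T unfolding two_def by (simp add: card_image)
qed

text \<open>Every line in a direction of \<open>K\<close> carries exactly one codeword of the
  section, and it is one of the two points of \<open>F\<close>.\<close>

lemma transversal_section:
  assumes sc: "single_code N M" and KN: "K \<subseteq> N" and dc: "double_code K F"
    and sub: "\<And>u. M (override_on v u K) \<Longrightarrow> F u"
  shows "transversal K F (\<lambda>u. M (override_on v u K))"
  unfolding transversal_def
proof (intro conjI ballI allI impI)
  show "depends_on K (\<lambda>u. M (override_on v u K))"
    using sc depends_on_override(1) unfolding single_code_def by blast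
  fix i x p assume i: "i \<in> K" and F: "F x" "F (x(i := p))" and ne: "p \<noteq> x i"
  have "\<exists>!r. M ((override_on v x K)(i := r))" using sc i KN unfolding single_code_def by blast
  then have ex: "\<exists>!r. M (override_on v (x(i := r)) K)" unfolding override_upd_in[OF i] .
  then obtain r where r: "M (override_on v (x(i := r)) K)" by blast
  have t: "two (\<lambda>p. F (x(i := p)))" using dc i unfolding double_code_def by blast
  have "r = p \<or> r = x i"
  proof (rule ccontr)
    assume "\<not> (r = p \<or> r = x i)"
    then have "F (x(i := r)) \<longleftrightarrow> \<not> F (x(i := p))"
      using two_third[OF t ne, of r] F by simp
    then show False using sub[OF r] F by blast
  qed
  then show "M (override_on v x K) \<noteq> M (override_on v (x(i := p)) K)"
    using ex r ne by (metis fun_upd_triv)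
qed (use sub in blast)

definition latin :: "nat set \<Rightarrow> ((nat \<Rightarrow> symb) \<Rightarrow> symb) \<Rightarrow> bool" where
  "latin K f \<longleftrightarrow> depends_on K f \<and> (\<forall>i\<in>K. \<forall>x t. \<exists>!p. f (x(i := p)) = t)"

text \<open>The four sections of \<open>M\<close> over \<open>v0\<close> as the coordinate \<open>l\<close> varies exhaust all sections: a
  connected code has only two transversals.\<close>

lemma split_of_prime_component:
  assumes fin: "finite N" and sc: "single_code N M" and l: "l \<in> N" and T: "two T"
    and sep: "separated (N - {l}) (shadow M l T) K" and K0: "k0 \<in> K"
    and con: "\<And>v s. connected_code K (\<lambda>u. shadow M l T (override_on v u K) \<longleftrightarrow> s)"
  shows "\<exists>\<phi> \<gamma>. latin K \<phi> \<and> latin (N - K) \<gamma> \<and> (\<forall>x. M x \<longleftrightarrow> \<phi> x = \<gamma> x)"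
proof -
  let ?D = "shadow M l T"
  have KN: "K \<subseteq> N" "l \<notin> K" "K \<subseteq> N - {l}" using sep unfolding separated_def by auto
  have dcD: "double_code (N - {l}) ?D" by (rule double_code_shadow[OF sc l T])
  then have depD: "depends_on (N - {l}) ?D" unfolding double_code_def by blast
  have depM: "depends_on N M" using sc unfolding single_code_def by blast
  \<comment> \<open>A codeword over \<open>v\<close> has its \<open>K\<close>-part in the section of
    the shadow if \<open>v l\<close> lies in \<open>T\<close>, and in the complement of that section
    otherwise. \<open>F v\<close> is the applicable one of the two.\<close>
  define F where "F v u \<longleftrightarrow> (?D (override_on v u K) \<longleftrightarrow> T (v l))" for v u
  have dcF: "double_code K (F v)" for v
  proof -
    have "double_code K (\<lambda>u. ?D (override_on v u K))" by (rule double_code_section[OF dcD KN(3)])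
    from this double_code_not[OF this] show ?thesis by (cases "T (v l)") (simp_all add: F_def[abs_def])
  qed
  have conF: "connected_code K (F v)" for v
    using con[of v "T (v l)"] unfolding F_def[abs_def] .
  have trM: "transversal K (F v) (\<lambda>u. M (override_on v u K))" for v
  proof (rule transversal_section[OF sc KN(1) dcF])
    fix u assume "M (override_on v u K)"
    from shadow_iff[OF sc l this, of T] show "F v u" using KN(2) unfolding F_def by simp
  qed
  \<comment> \<open>Arbitrary reference values off \<open>K\<close>, of which only the
    \<open>l\<close>-coordinate will vary.\<close>
  define v0 :: "nat \<Rightarrow> symb" where "v0 = (\<lambda>_. S0)"
  have ov_l: "override_on (v0(l := t)) u K = (override_on v0 u K)(l := t)" for t u
    by (rule override_upd_out[OF KN(2)])
  have ex1: "\<exists>!t. M (override_on (v0(l := t)) u K)" for u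
    unfolding ov_l using sc l unfolding single_code_def by blast
  have ex2: "\<exists>u. M (override_on v u K)" for v
  proof -
    have "\<exists>!p. M ((override_on v v K)(k0 := p))" using sc KN(1) K0 unfolding single_code_def by blast
    then show ?thesis unfolding override_upd_in[OF K0, symmetric] by blast
  qed
  have sect: "\<exists>t. \<forall>u. M (override_on v u K) \<longleftrightarrow> M (override_on (v0(l := t)) u K)" for v
  proof -
    \<comment> \<open>By additivity the section of the shadow over \<open>v\<close> equals the one
      over \<open>v0\<close> or its complement. \<open>?s\<close> is the truth value of
      \<open>T t\<close> that makes \<open>F (v0(l := t))\<close> coincide with \<open>F v\<close>;
      exactly two layers have it.\<close>
    let ?s = "?D (override_on v v0 K) \<longleftrightarrow> (?D (override_on v0 v0 K) \<longleftrightarrow> T (v l))"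
    have two_s: "two (\<lambda>t. T t = ?s)" by (rule two_iff_const[OF T])
    obtain t1 where t1: "T t1 = ?s" using two_ex[OF two_s] .
    obtain t2 where t2: "t2 \<noteq> t1" "T t2 = ?s" using two_ex_neq[OF two_s] .
    note t = t2(1)[symmetric] t1 t2(2)
    have Feq: "F (v0(l := t)) = F v" if "T t = ?s" for t
    proof
      fix u
      have "(?D (override_on v u K) \<longleftrightarrow> ?D (override_on v v0 K)) \<longleftrightarrow>
          (?D (override_on v0 u K) \<longleftrightarrow> ?D (override_on v0 v0 K))"
        by (rule separated_additive[OF _ depD sep]) (use fin in simp)
      then show "F (v0(l := t)) u = F v u" using that unfolding F_def ov_l by auto
    qed
    have tr1: "transversal K (F v) (\<lambda>u. M (override_on (v0(l := t1)) u K))"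
      and tr2: "transversal K (F v) (\<lambda>u. M (override_on (v0(l := t2)) u K))"
      using trM[of "v0(l := t1)"] trM[of "v0(l := t2)"] Feq t by auto
    have depF: "depends_on K (F v)" using dcF unfolding double_code_def by blast
    have "(\<forall>u. M (override_on v u K) \<longleftrightarrow> M (override_on (v0(l := t1)) u K)) \<or>
      (\<forall>u. M (override_on v u K) \<longleftrightarrow> F v u \<and> \<not> M (override_on (v0(l := t1)) u K))"
      by (rule transversals_of_connected[OF conF depF tr1 trM])
    moreover have "(\<forall>u. M (override_on (v0(l := t2)) u K) \<longleftrightarrow> M (override_on (v0(l := t1)) u K)) \<or>
      (\<forall>u. M (override_on (v0(l := t2)) u K) \<longleftrightarrow> F v u \<and> \<not> M (override_on (v0(l := t1)) u K))"
      by (rule transversals_of_connected[OF conF depF tr1 tr2])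
    \<comment> \<open>The layers \<open>t1\<close> and \<open>t2\<close> thus give two different,
      hence complementary, transversals of \<open>F v\<close>, and the section over \<open>v\<close>
      must be one of them.\<close>
    moreover have "\<not> (\<forall>u. M (override_on (v0(l := t2)) u K) \<longleftrightarrow> M (override_on (v0(l := t1)) u K))"
      using ex2[of "v0(l := t1)"] ex1 t(1) by blast
    ultimately show ?thesis by blast
  qed
  \<comment> \<open>\<open>\<phi> u\<close> is the layer whose reference section contains
    \<open>u\<close>, and \<open>\<gamma> v\<close> is the layer whose reference section equals the
    section over \<open>v\<close>.\<close>
  define \<phi> where "\<phi> u = (THE t. M (override_on (v0(l := t)) u K))" for u
  define \<gamma> where "\<gamma> v = (THE t. \<forall>u. M (override_on v u K) \<longleftrightarrow> M (override_on (v0(l := t)) u K))" for v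
  have phi: "\<phi> u = t \<longleftrightarrow> M (override_on (v0(l := t)) u K)" for u t
    unfolding \<phi>_def using theI'[OF ex1[of u]] ex1[of u] by blast
  have "\<exists>!t. \<forall>u. M (override_on v u K) \<longleftrightarrow> M (override_on (v0(l := t)) u K)" for v
  proof -
    obtain t where t: "\<forall>u. M (override_on v u K) \<longleftrightarrow> M (override_on (v0(l := t)) u K)"
      using sect[of v] ..
    obtain u where u: "M (override_on v u K)" using ex2[of v] ..
    show ?thesis
    proof (rule ex1I[of _ t])
      fix t' assume "\<forall>u. M (override_on v u K) \<longleftrightarrow> M (override_on (v0(l := t')) u K)"
      then show "t' = t" using t u ex1[of u] by blast
    qed (rule t)
  qed
  from theI'[OF this] have gam: "M (override_on v u K) \<longleftrightarrow> M (override_on (v0(l := \<gamma> v)) u K)" for u v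
    unfolding \<gamma>_def by blast
  have M: "M (override_on v u K) \<longleftrightarrow> \<phi> u = \<gamma> v" for u v using gam phi by blast
  have "latin K \<phi>"
    unfolding latin_def
  proof (intro conjI ballI allI)
    show "depends_on K \<phi>"
      unfolding depends_on_def
    proof (intro allI impI)
      fix x y :: "nat \<Rightarrow> symb" assume "\<forall>i\<in>K. x i = y i"
      then have "M (override_on v x K) = M (override_on v y K)" for v
        by (intro depends_onD[OF depends_on_override(1)[OF depM]]) blast
      then show "\<phi> x = \<phi> y" unfolding \<phi>_def by simp
    qed
    show "\<exists>!p. \<phi> (x(i := p)) = t" if i: "i \<in> K" for i x t
      unfolding phi override_upd_in[OF i] using sc i KN(1) unfolding single_code_def by blast
  qed
  moreover have "latin (N - K) \<gamma>"
    unfolding latin_def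
  proof (intro conjI ballI allI)
    show "depends_on (N - K) \<gamma>"
      unfolding depends_on_def
    proof (intro allI impI)
      fix x y :: "nat \<Rightarrow> symb" assume "\<forall>i\<in>N - K. x i = y i"
      then have "M (override_on x u K) = M (override_on y u K)" for u
        by (intro depends_onD[OF depends_on_override(2)[OF depM]]) blast
      then show "\<gamma> x = \<gamma> y" unfolding \<gamma>_def by simp
    qed
    fix i x t assume i: "i \<in> N - K"
    obtain u where u: "\<phi> u = t" using ex2 phi by blast
    have "\<exists>!p. M ((override_on x u K)(i := p))" using sc i unfolding single_code_def by blast
    moreover have "i \<notin> K" using i by blast
    ultimately have "\<exists>!p. M (override_on (x(i := p)) u K)" unfolding override_upd_out[OF \<open>i \<notin> K\<close>] by blast
    then show "\<exists>!p. \<gamma> (x(i := p)) = t" unfolding M u by (simp only: eq_commute[of t])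
  qed
  moreover have "M x \<longleftrightarrow> \<phi> x = \<gamma> x" for x using M[of x x] by simp
  ultimately show ?thesis by blast
qed

text \<open>The witness \<open>k\<close> ensures that the complement of \<open>K\<close> has an
  element besides \<open>l\<close>, so both sides of the equation involve at least two
  coordinates.\<close>

lemma split_of_single_code:
  assumes "finite N" "single_code N M" "l \<in> N" "two T"
    and disc: "\<not> connected_code (N - {l}) (shadow M l T)"
    and "i0 \<in> N - {l}" "j0 \<in> N - {l}" "i0 \<noteq> j0" "\<not> flat (shadow M l T) i0 j0"
  obtains K k \<phi> \<gamma> where "K \<subseteq> N - {l}" "i0 \<in> K" "j0 \<in> K" "k \<in> N - {l} - K"
    "latin K \<phi>" "latin (N - K) \<gamma>" "\<And>x. M x \<longleftrightarrow> \<phi> x = \<gamma> x"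
proof -
  have dc: "double_code (N - {l}) (shadow M l T)" by (rule double_code_shadow[OF assms(2-4)])
  obtain K where K: "separated (N - {l}) (shadow M l T) K" "i0 \<in> K" "j0 \<in> K" "K \<noteq> N - {l}"
    "\<And>v s. connected_code K (\<lambda>u. shadow M l T (override_on v u K) \<longleftrightarrow> s)"
    using prime_component[OF _ dc disc assms(6,7,9)] assms(1) by blast
  then have "K \<subseteq> N - {l}" unfolding separated_def by blast
  then show ?thesis
    using split_of_prime_component[OF assms(1-4) K(1,2,5)] that K by blast
qed

section \<open>Counting transversals\<close>

lemma flat_line:
  assumes fin: "finite I" and dep: "depends_on I D" and i: "i \<in> I"
    and fl: "\<And>j. j \<in> I \<Longrightarrow> j \<noteq> i \<Longrightarrow> flat D j i"
  shows "(D (x(i := p)) \<longleftrightarrow> D (x(i := p'))) \<longleftrightarrow> (D (y(i := p)) \<longleftrightarrow> D (y(i := p')))"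
proof (rule constant_if_invariant[where I = I and f = "\<lambda>x. D (x(i := p)) \<longleftrightarrow> D (x(i := p'))"])
  show "depends_on I (\<lambda>x. D (x(i := p)) \<longleftrightarrow> D (x(i := p')))"
    unfolding depends_on_def
  proof (intro allI impI)
    fix x y :: "nat \<Rightarrow> symb" assume "\<forall>k\<in>I. x k = y k"
    then have "D (x(i := p)) = D (y(i := p))" for p
      by (intro depends_onD[OF dep]) auto
    then show "(D (x(i := p)) \<longleftrightarrow> D (x(i := p'))) = (D (y(i := p)) \<longleftrightarrow> D (y(i := p')))" by simp
  qed
  fix j x r assume j: "j \<in> I"
  show "(D (x(j := r, i := p)) \<longleftrightarrow> D (x(j := r, i := p'))) = (D (x(i := p)) \<longleftrightarrow> D (x(i := p')))"
  proof (cases "j = i")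
    case False
    have "x(j := r, i := p) = x(i := p, j := r)" using False by (simp add: fun_upd_twist)
    moreover have "x(i := p, j := r, i := p') = x(j := r, i := p')" "x(i := p, i := p') = x(i := p')"
      using False by auto
    ultimately show ?thesis using fl[OF j False] unfolding flat_def by metis
  qed simp
qed (rule fin)

text \<open>The coordinates of \<open>x0\<close> are replaced by those of \<open>x\<close> one after
  another. By \<open>flat_line\<close>, each replacement flips \<open>D\<close> exactly when it does
  so at \<open>x0\<close> itself.\<close>

lemma flat_imp_linear:
  assumes fin: "finite I" and dep: "depends_on I D"
    and fl: "\<And>i j. i \<in> I \<Longrightarrow> j \<in> I \<Longrightarrow> i \<noteq> j \<Longrightarrow> flat D i j"
  shows "D x \<longleftrightarrow> (D x0 \<longleftrightarrow> even (\<Sum>i\<in>I. of_bool (D (x0(i := x i)) \<noteq> D x0) :: nat))"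
proof -
  have "D (override_on x0 x J) \<longleftrightarrow>
      (D x0 \<longleftrightarrow> even (\<Sum>i\<in>J. of_bool (D (x0(i := x i)) \<noteq> D x0) :: nat))"
    if "finite J" "J \<subseteq> I" for J
    using that
  proof (induction J rule: finite_induct)
    case empty then show ?case by (simp add: override_on_def)
  next
    case (insert j J)
    let ?w = "override_on x0 x J"
    have w: "override_on x0 x (insert j J) = ?w(j := x j)" "?w(j := x0 j) = ?w"
      using insert.hyps by (auto simp: override_on_def)
    have "(D (?w(j := x j)) \<longleftrightarrow> D (?w(j := x0 j))) \<longleftrightarrow> (D (x0(j := x j)) \<longleftrightarrow> D (x0(j := x0 j)))"
      by (rule flat_line[OF fin dep]) (use insert.prems fl in auto)
    then have "(D (override_on x0 x (insert j J)) \<longleftrightarrow> D ?w) \<longleftrightarrow> (D (x0(j := x j)) \<longleftrightarrow> D x0)"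
      unfolding w by simp
    moreover have "D ?w \<longleftrightarrow> (D x0 \<longleftrightarrow> even (\<Sum>i\<in>J. of_bool (D (x0(i := x i)) \<noteq> D x0) :: nat))"
      using insert by blast
    moreover have "even (\<Sum>i\<in>insert j J. of_bool (D (x0(i := x i)) \<noteq> D x0) :: nat) \<longleftrightarrow>
      ((D (x0(j := x j)) \<longleftrightarrow> D x0) \<longleftrightarrow> even (\<Sum>i\<in>J. of_bool (D (x0(i := x i)) \<noteq> D x0) :: nat))"
      unfolding sum.insert[OF insert.hyps] by simp
    ultimately show ?case by argo
  qed
  from this[OF fin order_refl]
  have "D (override_on x0 x I) \<longleftrightarrow>
      (D x0 \<longleftrightarrow> even (\<Sum>i\<in>I. of_bool (D (x0(i := x i)) \<noteq> D x0) :: nat))" .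
  moreover have "D (override_on x0 x I) = D x"
    by (rule depends_onD[OF dep]) (simp add: override_on_def)
  ultimately show ?thesis by simp
qed

section \<open>Counting points in faces\<close>

text \<open>The face through \<open>x\<close> with directions \<open>J\<close>. For predicates
  depending on \<open>I\<close>, the finite set \<open>cube x I\<close> represents all points, so
  cardinalities are taken there.\<close>

definition cube :: "(nat \<Rightarrow> symb) \<Rightarrow> nat set \<Rightarrow> (nat \<Rightarrow> symb) set" where
  "cube x J = {y. \<forall>k. k \<notin> J \<longrightarrow> y k = x k}"

lemma cube_insert: "cube x (insert j J) = (\<lambda>(y, p). y(j := p)) ` (cube x J \<times> UNIV)"
proof
  show "cube x (insert j J) \<subseteq> (\<lambda>(y, p). y(j := p)) ` (cube x J \<times> UNIV)"
  proof
    fix y assume y: "y \<in> cube x (insert j J)"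
    have "y = (\<lambda>(y, p). y(j := p)) (y(j := x j), y j)" by simp
    moreover have "y(j := x j) \<in> cube x J" using y by (auto simp: cube_def)
    ultimately show "y \<in> (\<lambda>(y, p). y(j := p)) ` (cube x J \<times> UNIV)" by blast
  qed
qed (auto simp: cube_def)

lemma card_UNIV_symb: "card (UNIV :: symb set) = 4"
  by (simp add: UNIV_symb)

lemma card_cube_le: "finite J \<Longrightarrow> finite (cube x J) \<and> card (cube x J) \<le> 4 ^ card J"
proof (induction J rule: finite_induct)
  case empty
  have "cube x {} = {x}" by (auto simp: cube_def)
  then show ?case by simp
next
  case (insert j J)
  have "card (cube x (insert j J)) \<le> card (cube x J \<times> (UNIV :: symb set))"
    unfolding cube_insert using insert by (intro card_image_le) simp
  then show ?case using insert by (simp add: cube_insert card_cartesian_product card_UNIV_symb)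
qed

lemmas finite_cube = card_cube_le[THEN conjunct1]

text \<open>Moving every point of the slice to another layer in direction \<open>i\<close> gives a
  disjoint copy of it; resetting coordinate \<open>i\<close> to \<open>x i\<close> undoes the move,
  so the copy has the same size.\<close>

lemma card_slice_insert:
  assumes fin: "finite J" and i: "i \<notin> J"
    and cl: "\<And>y. y \<in> S \<Longrightarrow> \<exists>p. p \<noteq> y i \<and> y(i := p) \<in> S"
  shows "2 * card (S \<inter> cube x J) \<le> card (S \<inter> cube x (insert i J))"
proof -
  obtain r where r: "\<And>y. y \<in> S \<Longrightarrow> r y \<noteq> y i \<and> y(i := r y) \<in> S"
    using cl by metis
  let ?A = "S \<inter> cube x J"
  let ?g = "\<lambda>y. y(i := r y)"
  have finA: "finite ?A" using finite_cube[OF fin] by blast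
  have undo: "(?g y)(i := x i) = y" if "y \<in> ?A" for y
    using that i by (auto simp: cube_def)
  have inj: "inj_on ?g ?A" by (rule inj_on_inverseI[where g = "\<lambda>y. y(i := x i)"]) (rule undo)
  have disj: "?A \<inter> ?g ` ?A = {}"
  proof (rule ccontr)
    assume "?A \<inter> ?g ` ?A \<noteq> {}"
    then obtain y where y: "y \<in> ?A" "?g y \<in> ?A" by blast
    then have "y i = x i" "(?g y) i = x i" using i unfolding cube_def by blast+
    moreover have "r y \<noteq> y i" using r y by blast
    ultimately show False by simp
  qed
  have "card (?A \<union> ?g ` ?A) = 2 * card ?A"
    by (simp only: card_Un_disjoint[OF finA finite_imageI[OF finA] disj] card_image[OF inj] mult_2)
  moreover have "card (?A \<union> ?g ` ?A) \<le> card (S \<inter> cube x (insert i J))"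
  proof (rule card_mono)
    show "finite (S \<inter> cube x (insert i J))" using finite_cube[of "insert i J" x] fin by blast
    have "?g y \<in> S \<inter> cube x (insert i J)" if "y \<in> ?A" for y
      using r[of y] that by (simp add: cube_def)
    moreover have "?A \<subseteq> S \<inter> cube x (insert i J)" by (auto simp: cube_def)
    ultimately show "?A \<union> ?g ` ?A \<subseteq> S \<inter> cube x (insert i J)" by blast
  qed
  ultimately show ?thesis by simp
qed

lemma card_slice:
  assumes "finite G" "finite J" "G \<inter> J = {}"
    and "\<And>i y. i \<in> G \<Longrightarrow> y \<in> S \<Longrightarrow> \<exists>p. p \<noteq> y i \<and> y(i := p) \<in> S"
  shows "2 ^ card G * card (S \<inter> cube x J) \<le> card (S \<inter> cube x (G \<union> J))"
  using assms
proof (induction G rule: finite_induct)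
  case (insert i G)
  have "2 * card (S \<inter> cube x (G \<union> J)) \<le> card (S \<inter> cube x (insert i (G \<union> J)))"
    by (rule card_slice_insert) (use insert.hyps insert.prems in blast)+
  moreover have "2 ^ card G * card (S \<inter> cube x J) \<le> card (S \<inter> cube x (G \<union> J))"
    using insert by auto
  ultimately show ?case using insert.hyps by simp
qed simp

section \<open>Bounds for the number of transversals\<close>

lemma transversal_eqI:
  assumes "transversal I D U" "transversal I D U'" "\<And>x. x \<in> cube x0 I \<Longrightarrow> D x \<Longrightarrow> U x \<longleftrightarrow> U' x"
  shows "U = U'"
proof
  fix x
  let ?y = "override_on x0 x I"
  have "depends_on I U" "depends_on I U'" using assms(1,2) unfolding transversal_def by blast+
  then have "U ?y = U x" "U' ?y = U' x"
    unfolding depends_on_def by simp_all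
  moreover have "?y \<in> cube x0 I" by (simp add: cube_def override_on_def)
  ultimately show "U x = U' x" using assms unfolding transversal_def by metis
qed

lemma finite_transversals:
  assumes "finite I" shows "finite {U. transversal I D U}"
proof -
  fix x0
  have "inj_on (\<lambda>U. {x\<in>cube x0 I. U x}) {U. transversal I D U}"
    by (rule inj_onI) (use transversal_eqI[of I D _ _ x0] in blast)
  moreover have "(\<lambda>U. {x\<in>cube x0 I. U x}) ` {U. transversal I D U} \<subseteq> Pow (cube x0 I)" by auto
  ultimately show ?thesis using finite_cube[OF assms, of x0] by (meson finite_Pow_iff inj_on_finite)
qed

text \<open>A transversal of a connected code is determined by its truth value at one point of the
  code.\<close>

lemma card_transversals_connected:
  assumes "double_code I D" "connected_code I D" "i \<in> I"
  shows "card {U. transversal I D U} \<le> 2"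
proof -
  have dep: "depends_on I D" using assms unfolding double_code_def by blast
  fix x
  have "two (\<lambda>p. D (x(i := p)))" using assms unfolding double_code_def by blast
  then obtain x0 where x0: "D x0" using two_ex by metis
  have "inj_on (\<lambda>U. U x0) {U. transversal I D U}"
  proof (rule inj_onI)
    fix U U' assume "U \<in> {U. transversal I D U}" "U' \<in> {U. transversal I D U}" "U x0 = U' x0"
    then show "U = U'"
      using transversals_of_connected[OF assms(2) dep, of U U'] x0 by auto
  qed
  from card_inj_on_le[OF this, of UNIV] show ?thesis by simp
qed

text \<open>The set \<open>bits x\<close> is constant along edges of \<open>D\<close>, so it labels
  unions of components. Flipping \<open>U\<close> on the points whose label lies in \<open>W\<close>
  gives a transversal \<open>V W\<close>, and different \<open>W\<close> give different
  transversals.\<close>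

lemma card_transversals_flat:
  assumes fin: "finite I" and dc: "double_code I D" and U: "transversal I D U"
    and fl: "\<And>i j. i \<in> I \<Longrightarrow> j \<in> I \<Longrightarrow> i \<noteq> j \<Longrightarrow> flat D i j" and k0: "k0 \<in> I"
  shows "2 ^ (2 ^ (card I - 1)) \<le> card {U. transversal I D U}"
proof -
  have dep: "depends_on I D" using dc unfolding double_code_def by blast
  fix x0 :: "nat \<Rightarrow> symb"
  let ?I = "I - {k0}"
  let ?\<chi> = "\<lambda>i p. D (x0(i := p)) \<noteq> D x0"
  \<comment> \<open>The bit of \<open>k0\<close> is left out, since by linearity it is determined by
    the others inside \<open>D\<close>. This leaves \<open>2 ^ (card I - 1)\<close> labels.\<close>
  define bits where "bits x = {i\<in>?I. ?\<chi> i (x i)}" for x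
  define V where "V W x \<longleftrightarrow> D x \<and> (U x \<longleftrightarrow> bits x \<notin> W)" for W x
  have bits_upd: "bits (x(i := p)) = bits x" if "i \<in> I" "D x" "D (x(i := p))" for x i p
  proof -
    have "(D (x(i := p)) \<longleftrightarrow> D (x(i := x i))) \<longleftrightarrow> (D (x0(i := p)) \<longleftrightarrow> D (x0(i := x i)))"
      by (rule flat_line[OF fin dep that(1)]) (use fl that in auto)
    then have "?\<chi> i p = ?\<chi> i (x i)" using that by simp
    then show ?thesis unfolding bits_def by auto
  qed
  have "transversal I D (V W)" for W
    unfolding transversal_def
  proof (intro conjI ballI allI impI)
    show "depends_on I (V W)"
      unfolding depends_on_def
    proof (intro allI impI)
      fix x y :: "nat \<Rightarrow> symb" assume xy: "\<forall>i\<in>I. x i = y i"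
      then have "D x = D y" "U x = U y"
        using dep U unfolding transversal_def depends_on_def by blast+
      moreover have "bits x = bits y" using xy unfolding bits_def by auto
      ultimately show "V W x = V W y" unfolding V_def by simp
    qed
    show "V W x \<Longrightarrow> D x" for x unfolding V_def by simp
    fix i x p assume a: "i \<in> I" "D x" "D (x(i := p))" "p \<noteq> x i"
    then have "U x \<noteq> U (x(i := p))" using U unfolding transversal_def by blast
    then show "V W x \<noteq> V W (x(i := p))" using bits_upd a unfolding V_def by simp
  qed
  then have sub: "V ` Pow (Pow ?I) \<subseteq> {U. transversal I D U}" by blast
  have ex: "\<exists>p. ?\<chi> i p = s" if "i \<in> I" for i s
  proof -
    have "two (\<lambda>p. D (x0(i := p)))" using dc that unfolding double_code_def by blast
    from two_ex[OF two_iff_const[OF this, of "D x0 \<noteq> s"]] show ?thesis by (metis (full_types))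
  qed
  \<comment> \<open>The other coordinates are chosen to realise the label; coordinate
    \<open>k0\<close> is then used to land in \<open>D\<close>.\<close>
  have surj: "\<exists>x. D x \<and> bits x = B" if "B \<subseteq> ?I" for B
  proof -
    have "\<forall>i\<in>I. \<exists>p. ?\<chi> i p = (i \<in> B)" using ex by blast
    from bchoice[OF this] obtain y where y: "\<And>i. i \<in> I \<Longrightarrow> ?\<chi> i (y i) = (i \<in> B)" by blast
    have "two (\<lambda>p. D (y(k0 := p)))" using dc k0 unfolding double_code_def by blast
    then obtain p where p: "D (y(k0 := p))" by (rule two_ex)
    have "bits (y(k0 := p)) = bits y" unfolding bits_def by auto
    also have "\<dots> = B" using y that unfolding bits_def by blast
    finally show ?thesis using p by blast
  qed
  have "inj_on V (Pow (Pow ?I))"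
  proof (rule inj_onI)
    fix W W' assume W: "W \<in> Pow (Pow ?I)" "W' \<in> Pow (Pow ?I)" "V W = V W'"
    have "B \<in> W \<longleftrightarrow> B \<in> W'" if "B \<subseteq> ?I" for B
    proof -
      from surj[OF that] obtain x where "D x \<and> bits x = B" ..
      then show ?thesis using fun_cong[OF W(3), of x] unfolding V_def by auto
    qed
    then show "W = W'" using W by blast
  qed
  then have "card (Pow (Pow ?I)) \<le> card {U. transversal I D U}"
    by (rule card_inj_on_le[OF _ sub finite_transversals[OF fin]])
  moreover have "card (Pow (Pow ?I)) = 2 ^ (2 ^ (card I - 1))"
    using fin by (simp only: card_Pow finite_Pow_iff finite_Diff card_Diff_singleton[OF k0])
  ultimately show ?thesis by (simp only:)
qed

text \<open>In the plane of a nonzero mixed difference a closed set \<open>A\<close> cannot colour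
  the lines differently, because \<open>coloured_plane\<close> would make the difference vanish. So
  if \<open>A\<close> meets the plane, it contains all points of \<open>D\<close> there, two on each
  of four lines.\<close>

lemma nonflat_plane:
  assumes i: "i \<in> I" and j: "j \<in> I" and ne: "i \<noteq> j" and dc: "double_code I D"
    and nf: "\<not> flat D i j"
  obtains x where "\<And>A. (\<And>y. y \<in> A \<Longrightarrow> D y) \<Longrightarrow>
    (\<And>k y p. k \<in> {i, j} \<Longrightarrow> y \<in> A \<Longrightarrow> D (y(k := p)) \<Longrightarrow> y(k := p) \<in> A) \<Longrightarrow>
    A \<inter> cube x {i, j} \<noteq> {} \<Longrightarrow> card (A \<inter> cube x {i, j}) = 8"
proof -
  obtain x p0 q0 where x: "\<not> ((D x \<longleftrightarrow> D (x(i := p0))) \<longleftrightarrow> (D (x(j := q0)) \<longleftrightarrow> D (x(i := p0, j := q0))))"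
    using nf unfolding flat_def by blast
  have cubeE: "\<exists>p q. y = x(j := q, i := p)" if "y \<in> cube x {i, j}" for y
  proof -
    have "y = x(j := y j, i := y i)" using that ne by (auto simp: cube_def)
    then show ?thesis by blast
  qed
  have plane: "card (A \<inter> cube x {i, j}) = 8"
    if sub: "\<And>y. y \<in> A \<Longrightarrow> D y"
      and cl: "\<And>k y p. k \<in> {i, j} \<Longrightarrow> y \<in> A \<Longrightarrow> D (y(k := p)) \<Longrightarrow> y(k := p) \<in> A"
      and nonempty: "A \<inter> cube x {i, j} \<noteq> {}" for A
  proof -
    define d where "d p q = D (x(j := q, i := p))" for p q
    define c where "c q \<longleftrightarrow> (\<exists>p. x(j := q, i := p) \<in> A)" for q
    have tw: "x(j := q, i := p) = x(i := p, j := q)" for p q using ne by (simp add: fun_upd_twist)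
    have row: "x(j := q, i := p) \<in> A \<longleftrightarrow> d p q \<and> c q" for p q
      using sub cl[of i "x(j := q, i := _)" p] unfolding c_def d_def by auto
    have col: "x(j := q', i := p) \<in> A" if "x(j := q, i := p) \<in> A" "d p q'" for p q q'
      using cl[of j "x(i := p, j := q)" q'] that unfolding d_def tw by simp
    have compl: "d p q \<longleftrightarrow> \<not> d p q'" if "c q \<noteq> c q'" for p q q'
    proof (rule two_disjoint[of "\<lambda>p. d p q'" "\<lambda>p. d p q"])
      show "two (\<lambda>p. d p q')" "two (\<lambda>p. d p q)" unfolding d_def
        using dc i unfolding double_code_def by blast+
      show "\<not> (d p q' \<and> d p q)" for p using that col row by blast
    qed
    have "c q = c q'" for q q'
    proof (rule ccontr)
      assume bi: "c q \<noteq> c q'"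
      have "(d p r \<longleftrightarrow> d p r') \<longleftrightarrow> (c r \<longleftrightarrow> c r')" for p r r'
        by (rule coloured_plane[of c d, OF _ bi]) (rule compl)
      then have "(d (x i) (x j) \<longleftrightarrow> d (x i) q0) \<longleftrightarrow> (d p0 (x j) \<longleftrightarrow> d p0 q0)" by simp
      moreover have "d (x i) (x j) = D x" "d (x i) q0 = D (x(j := q0))"
        "d p0 (x j) = D (x(i := p0))" "d p0 q0 = D (x(i := p0, j := q0))"
        unfolding d_def tw[of q0 p0] using ne by (auto intro!: arg_cong[of _ _ D])
      ultimately show False using x by argo
    qed
    moreover have "\<exists>q. c q" using nonempty cubeE unfolding c_def by blast
    ultimately have all: "x(j := q, i := p) \<in> A \<longleftrightarrow> d p q" for p q using row by blast
    let ?f = "\<lambda>(q, p). x(j := q, i := p)"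
    have "A \<inter> cube x {i, j} = ?f ` (SIGMA q:UNIV. {p. d p q})"
    proof
      show "A \<inter> cube x {i, j} \<subseteq> ?f ` (SIGMA q:UNIV. {p. d p q})"
      proof
        fix y assume y: "y \<in> A \<inter> cube x {i, j}"
        then obtain p q where "y = x(j := q, i := p)" using cubeE by blast
        then show "y \<in> ?f ` (SIGMA q:UNIV. {p. d p q})" using y all by auto
      qed
      show "?f ` (SIGMA q:UNIV. {p. d p q}) \<subseteq> A \<inter> cube x {i, j}" using all by (auto simp: cube_def)
    qed
    moreover have "inj_on ?f (SIGMA q:UNIV. {p. d p q})"
    proof (rule inj_onI, clarify)
      fix q p q' p' assume "x(j := q, i := p) = x(j := q', i := p')"
      then have "(x(j := q, i := p)) i = (x(j := q', i := p')) i" "(x(j := q, i := p)) j = (x(j := q', i := p')) j"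
        by metis+
      then show "q = q' \<and> p = p'" using ne by simp
    qed
    moreover have "card {p. d p q} = 2" for q
    proof -
      have "two (\<lambda>p. d p q)" unfolding d_def using dc i unfolding double_code_def by blast
      then show ?thesis by (simp add: two_def)
    qed
    moreover have "card (SIGMA q:(UNIV :: symb set). {p. d p q}) = 8"
      using card_SigmaI[of "UNIV :: symb set" "\<lambda>q. {p. d p q}"] calculation(3) card_UNIV_symb by simp
    ultimately show ?thesis by (simp add: card_image)
  qed
  show ?thesis by (rule that) (rule plane)
qed

lemma card_double_code_le:
  assumes fin: "finite I" and dc: "double_code I D" and i: "i \<in> I"
  shows "card {y\<in>cube x I. D y} \<le> 2 * 4 ^ (card I - 1)"
proof -
  let ?S = "SIGMA y:cube x (I - {i}). {p. D (y(i := p))}"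
  have finC: "finite (cube x (I - {i}))" by (rule finite_cube) (use fin in simp)
  have finS: "finite ?S" using finC by simp
  have "{y\<in>cube x I. D y} \<subseteq> (\<lambda>(y, p). y(i := p)) ` ?S"
  proof
    fix y assume y: "y \<in> {y\<in>cube x I. D y}"
    have "(y(i := x i), y i) \<in> ?S" using y by (auto simp: cube_def)
    moreover have "y = (\<lambda>(y, p). y(i := p)) (y(i := x i), y i)" by simp
    ultimately show "y \<in> (\<lambda>(y, p). y(i := p)) ` ?S" by (rule rev_image_eqI)
  qed
  then have "card {y\<in>cube x I. D y} \<le> card ((\<lambda>(y, p). y(i := p)) ` ?S)"
    by (rule card_mono[OF finite_imageI[OF finS]])
  also have "\<dots> \<le> card ?S" by (rule card_image_le[OF finS])
  also have "card ?S = (\<Sum>y\<in>cube x (I - {i}). card {p. D (y(i := p))})"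
    by (rule card_SigmaI) (use finC in auto)
  also have "\<dots> = card (cube x (I - {i})) * 2"
    using dc i unfolding double_code_def two_def by simp
  also have "\<dots> \<le> 4 ^ card (I - {i}) * 2"
    using card_cube_le[of "I - {i}" x] fin by simp
  also have "card (I - {i}) = card I - 1" by (rule card_Diff_singleton[OF i])
  finally show ?thesis by (simp only: mult.commute)
qed

lemma cube_eq: "y \<in> cube x J \<Longrightarrow> cube y J = cube x J"
  by (auto simp: cube_def)

text \<open>The points of the code fall into classes on which transversals can only be flipped as a
  whole. Every class has at least \<open>2 ^ card I\<close> points and one has twice that many,
  while the code has at most \<open>2 ^ (card I - 1) * 2 ^ card I\<close>, so there are fewer than
  \<open>2 ^ (card I - 1)\<close> classes.\<close>

lemma card_transversals_nonflat:
  assumes fin: "finite I" and dc: "double_code I D" and i: "i \<in> I" and j: "j \<in> I"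
    and ne: "i \<noteq> j" and nf: "\<not> flat D i j"
  shows "card {U. transversal I D U} < 2 ^ (2 ^ (card I - 1))"
proof (cases "{U. transversal I D U} = {}")
  case True
  then show ?thesis by (simp only: card.empty) simp
next
  case False
  let ?B = "{U. transversal I D U}"
  obtain U0 where U0: "U0 \<in> ?B" using False by blast
  obtain x where plane: "\<And>A. (\<And>y. y \<in> A \<Longrightarrow> D y) \<Longrightarrow>
    (\<And>k y p. k \<in> {i, j} \<Longrightarrow> y \<in> A \<Longrightarrow> D (y(k := p)) \<Longrightarrow> y(k := p) \<in> A) \<Longrightarrow>
    A \<inter> cube x {i, j} \<noteq> {} \<Longrightarrow> card (A \<inter> cube x {i, j}) = 8"
    using nonflat_plane[OF i j ne dc nf] by metis
  define W where "W = {y\<in>cube x I. D y}"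
  \<comment> \<open>Two points are equivalent if any two transversals agree at both or disagree at
    both. A step inside \<open>D\<close> flips every transversal and so stays in the class; thus
    classes are unions of components.\<close>
  define r where "r = {(y, z). y \<in> W \<and> z \<in> W \<and>
    (\<forall>U\<in>?B. \<forall>U'\<in>?B. (U y \<longleftrightarrow> U' y) \<longleftrightarrow> (U z \<longleftrightarrow> U' z))}"
  have finW: "finite W" unfolding W_def using finite_cube[OF fin] by simp
  have eq: "equiv W r"
    by (rule equivI) (auto simp: r_def refl_on_def sym_def trans_def)
  have rD: "(U y \<longleftrightarrow> U' y) \<longleftrightarrow> (U z \<longleftrightarrow> U' z)" if "(y, z) \<in> r" "U \<in> ?B" "U' \<in> ?B" for y z U U'
    using that unfolding r_def by simp
  have two_line: "two (\<lambda>p. D (y(k := p)))" if "k \<in> I" for k y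
    using dc that unfolding double_code_def by blast
  have step: "(y, y(k := p)) \<in> r" if "k \<in> I" "y \<in> W" "D (y(k := p))" for y k p
  proof (cases "p = y k")
    case True then show ?thesis using eq that by (simp add: equiv_def refl_on_def)
  next
    case False
    have "y(k := p) \<in> W" using that unfolding W_def cube_def by auto
    then have "y \<in> W \<and> y(k := p) \<in> W" using that by blast
    moreover have "U y \<noteq> U (y(k := p))" if "U \<in> ?B" for U
      using that \<open>k \<in> I\<close> \<open>y \<in> W\<close> \<open>D (y(k := p))\<close> False unfolding transversal_def W_def by blast
    ultimately show ?thesis unfolding r_def by blast
  qed
  have cW: "c \<subseteq> W" if "c \<in> W // r" for c using in_quotient_imp_subset[OF eq that] .
  have cl: "y(k := p) \<in> c" if "c \<in> W // r" "k \<in> I" "y \<in> c" "D (y(k := p))" for c y k p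
    using in_quotient_imp_closed[OF eq that(1,3)] step that cW by blast
  have cl': "\<exists>p. p \<noteq> y k \<and> y(k := p) \<in> c" if c: "c \<in> W // r" "k \<in> I" "y \<in> c" for c y k
  proof -
    obtain p where "p \<noteq> y k" "D (y(k := p))" using two_ex_neq[OF two_line[OF c(2)]] .
    then show ?thesis using cl c by blast
  qed
  have c_cube: "c \<inter> cube x I = c" if "c \<in> W // r" for c using cW[OF that] unfolding W_def by blast
  have big: "2 ^ card I \<le> card c" if c: "c \<in> W // r" for c
  proof -
    obtain y where y: "y \<in> c" using in_quotient_imp_non_empty[OF eq c] by blast
    have "2 ^ card I * card (c \<inter> cube y {}) \<le> card (c \<inter> cube y (I \<union> {}))"
      by (rule card_slice[OF fin]) (use cl'[OF c] in auto)
    moreover have "c \<inter> cube y {} = {y}" using y by (auto simp: cube_def)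
    moreover have "cube y (I \<union> {}) = cube x I"
      using cube_eq[of y x I] y cW[OF c] unfolding W_def by auto
    ultimately show ?thesis using c_cube[OF c] by simp
  qed
  \<comment> \<open>The class of a point in the nonflat plane contains all eight points of
    \<open>D\<close> there, twice the four points that a general class has in a plane it meets as a
    lower bound.\<close>
  obtain p where p: "D (x(i := p))" using two_ex[OF two_line[OF i]] .
  define c0 where "c0 = r `` {x(i := p)}"
  have xW: "x(i := p) \<in> W" using p i unfolding W_def cube_def by auto
  have c0: "c0 \<in> W // r" unfolding c0_def by (rule quotientI[OF xW])
  have "card (c0 \<inter> cube x {i, j}) = 8"
  proof (rule plane)
    show "y \<in> c0 \<Longrightarrow> D y" for y using cW[OF c0] unfolding W_def by blast
    show "k \<in> {i, j} \<Longrightarrow> y \<in> c0 \<Longrightarrow> D (y(k := p)) \<Longrightarrow> y(k := p) \<in> c0" for k y p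
      using cl[OF c0] i j by blast
    have "x(i := p) \<in> c0" unfolding c0_def by (rule equiv_class_self[OF eq xW])
    moreover have "x(i := p) \<in> cube x {i, j}" by (simp add: cube_def)
    ultimately show "c0 \<inter> cube x {i, j} \<noteq> {}" by blast
  qed
  moreover have "2 ^ card (I - {i, j}) * card (c0 \<inter> cube x {i, j}) \<le>
      card (c0 \<inter> cube x ((I - {i, j}) \<union> {i, j}))"
    by (rule card_slice) (use fin cl'[OF c0] in auto)
  moreover have "(I - {i, j}) \<union> {i, j} = I" using i j by blast
  ultimately have "2 ^ card (I - {i, j}) * 8 \<le> card c0" using c_cube[OF c0] by simp
  moreover have "card I = card (I - {i, j}) + 2"
    using card_Diff_subset[of "{i, j}" I] card_mono[of I "{i, j}"] i j ne fin by simp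
  ultimately have big0: "2 ^ card I + 2 ^ card I \<le> card c0" by (simp add: power_add)
  have finQ: "finite (W // r)" using finite_quotient[OF finW] eq by (simp add: equiv_def refl_on_def)
  \<comment> \<open>The extra summand is the surplus of \<open>c0\<close> and makes the final
    inequality strict.\<close>
  have "(\<Sum>c\<in>W // r. 2 ^ card I) + 2 ^ card I \<le> (\<Sum>c\<in>W // r. card c)"
  proof -
    have "(\<Sum>c\<in>W // r - {c0}. 2 ^ card I) \<le> (\<Sum>c\<in>W // r - {c0}. card c)"
      by (rule sum_mono) (use big in blast)
    then show ?thesis
      using sum.remove[OF finQ c0, of "\<lambda>_. 2 ^ card I :: nat"] sum.remove[OF finQ c0, of card] big0 by linarith
  qed
  also have "(\<Sum>c\<in>W // r. card c) = card (\<Union> (W // r))"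
    by (rule card_Union_disjoint[symmetric])
       (use quotient_disj[OF eq] cW finite_subset[OF _ finW] in \<open>auto simp: pairwise_def disjnt_def\<close>)
  also have "\<Union> (W // r) = W" by (rule Union_quotient[OF eq])
  also have "card W \<le> 2 * 4 ^ (card I - 1)" unfolding W_def by (rule card_double_code_le[OF fin dc i])
  also have "2 * 4 ^ (card I - 1) = 2 ^ (card I - 1) * (2 ^ card I :: nat)"
  proof -
    obtain m where m: "card I = Suc m" using i fin by (metis card_Suc_Diff1)
    have "(4::nat) ^ m = 2 ^ m * 2 ^ m" by (simp flip: power_mult_distrib)
    then show ?thesis unfolding m by simp
  qed
  finally have "(card (W // r) + 1) * 2 ^ card I \<le> 2 ^ (card I - 1) * 2 ^ card I"
    by simp
  then have "card (W // r) + 1 \<le> 2 ^ (card I - 1)" by (rule mult_right_le_imp_le) simp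
  then have less: "card (W // r) < 2 ^ (card I - 1)" by simp
  have "card ?B \<le> card (Pow (W // r))"
  proof (rule card_inj_on_le)
    \<comment> \<open>A transversal is encoded by the classes on which it differs from the fixed
      \<open>U0\<close>; differing at one point of a class means differing at all of them.\<close>
    show "inj_on (\<lambda>U. {c\<in>W // r. \<exists>y\<in>c. U y \<noteq> U0 y}) ?B"
    proof (rule inj_onI)
      fix U U' assume U: "U \<in> ?B" "U' \<in> ?B"
        and e: "{c\<in>W // r. \<exists>y\<in>c. U y \<noteq> U0 y} = {c\<in>W // r. \<exists>y\<in>c. U' y \<noteq> U0 y}"
      have "U y \<longleftrightarrow> U' y" if y: "y \<in> cube x I" "D y" for y
      proof -
        have yW: "y \<in> W" using y unfolding W_def by simp
        have mem: "r `` {y} \<in> {c\<in>W // r. \<exists>y\<in>c. V y \<noteq> U0 y} \<longleftrightarrow> V y \<noteq> U0 y" if V: "V \<in> ?B" for V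
        proof
          assume "r `` {y} \<in> {c\<in>W // r. \<exists>y\<in>c. V y \<noteq> U0 y}"
          then obtain z where "(y, z) \<in> r" "V z \<noteq> U0 z" by blast
          then show "V y \<noteq> U0 y" using rD[OF _ V U0] by blast
        next
          assume "V y \<noteq> U0 y"
          then have "\<exists>z\<in>r `` {y}. V z \<noteq> U0 z" using equiv_class_self[OF eq yW] by (rule bexI)
          then show "r `` {y} \<in> {c\<in>W // r. \<exists>y\<in>c. V y \<noteq> U0 y}"
            using quotientI[OF yW] by simp
        qed
        show ?thesis using mem[OF U(1)] mem[OF U(2)] unfolding e by blast
      qed
      then show "U = U'" using transversal_eqI[of I D U U' x] U by blast
    qed
  qed (use finQ in auto)
  also have "\<dots> = 2 ^ card (W // r)" by (rule card_Pow[OF finQ])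
  also have "\<dots> < 2 ^ (2 ^ (card I - 1))" using less by simp
  finally show ?thesis .
qed

section \<open>Completions correspond to transversals\<close>

lemma transversal_ex1:
  assumes dc: "double_code K E" and U: "transversal K E U" and i: "i \<in> K"
  shows "\<exists>!p. U (x(i := p))"
proof -
  have t: "two (\<lambda>p. E (x(i := p)))" using dc i unfolding double_code_def by blast
  have flip: "U (x(i := p)) \<noteq> U (x(i := p'))" if "E (x(i := p))" "E (x(i := p'))" "p \<noteq> p'" for p p'
    using U i that unfolding transversal_def by (metis fun_upd_same fun_upd_upd)
  obtain p where p: "E (x(i := p))" using two_ex[OF t] .
  obtain p' where p': "p' \<noteq> p" "E (x(i := p'))" using two_ex_neq[OF t] .
  have sub: "\<And>y. U y \<Longrightarrow> E y" using U unfolding transversal_def by blast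
  show ?thesis using flip[OF p p'(2)] p'(1) flip sub by metis
qed

lemma transversal_compl:
  assumes "depends_on K E" "transversal K E U"
  shows "transversal K E (\<lambda>x. E x \<and> \<not> U x)"
  unfolding transversal_def
proof (intro conjI ballI allI impI)
  show "depends_on K (\<lambda>x. E x \<and> \<not> U x)"
    using assms unfolding transversal_def depends_on_def by metis
  fix i x p assume "i \<in> K" "E x" "E (x(i := p))" "p \<noteq> x i"
  then show "(E x \<and> \<not> U x) \<noteq> (E (x(i := p)) \<and> \<not> U (x(i := p)))"
    using assms(2) unfolding transversal_def by blast
qed blast

definition completions ::
    "nat set \<Rightarrow> ((nat \<Rightarrow> symb) \<Rightarrow> bool) \<Rightarrow> nat \<Rightarrow> (symb \<Rightarrow> bool) \<Rightarrow> ((nat \<Rightarrow> symb) \<Rightarrow> bool) set" where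
  "completions N M l T = {M'. single_code N M' \<and> (\<forall>x. \<not> T (x l) \<longrightarrow> M' x = M x)}"

text \<open>The complement of the shadow of \<open>T\<close> is the shadow of the prescribed layers,
  which both codes share.\<close>

lemma shadow_completion:
  assumes "single_code N M" "l \<in> N" "M' \<in> completions N M l T"
  shows "shadow M' l T = shadow M l T"
proof
  fix x
  have "single_code N M'" using assms unfolding completions_def by blast
  moreover have "shadow M' l (\<lambda>t. \<not> T t) x = shadow M l (\<lambda>t. \<not> T t) x"
    using assms(3) unfolding completions_def shadow_def by auto
  ultimately show "shadow M' l T x = shadow M l T x"
    using shadow_not[of N M' l T x] shadow_not[of N M l T x] assms by blast
qed

lemma transversal_of_completion:
  assumes sc: "single_code N M" and l: "l \<in> N" and T: "two T" and t0: "T t0"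
    and M': "M' \<in> completions N M l T"
  shows "transversal (N - {l}) (shadow M l T) (\<lambda>x. M' (x(l := t0)))"
proof -
  have sc': "single_code N M'" using M' unfolding completions_def by blast
  have eq: "M' (override_on (\<lambda>_. t0) u (N - {l})) = M' (u(l := t0))" for u
    using sc' unfolding single_code_def
    by (intro depends_onD[of N M']) (auto simp: override_on_def)
  have "transversal (N - {l}) (shadow M l T) (\<lambda>u. M' (override_on (\<lambda>_. t0) u (N - {l})))"
  proof (rule transversal_section[OF sc' _ double_code_shadow[OF sc l T]])
    fix u assume "M' (override_on (\<lambda>_. t0) u (N - {l}))"
    then have "shadow M' l T u" unfolding eq shadow_def using t0 by blast
    then show "shadow M l T u" using shadow_completion[OF sc l M'] by simp
  qed blast
  then show ?thesis unfolding eq .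
qed

text \<open>A completion is recovered from its layer \<open>t0\<close>, because the other free layer
  \<open>t1\<close> must hold exactly the rest of the shadow. Conversely, any transversal may fill
  layer \<open>t0\<close>; the map \<open>ext\<close> is this inverse.\<close>

lemma card_completions:
  assumes sc: "single_code N M" and l: "l \<in> N" and T: "two T"
  shows "card (completions N M l T) = card {U. transversal (N - {l}) (shadow M l T) U}"
proof -
  let ?D = "shadow M l T"
  have dc: "double_code (N - {l}) ?D" by (rule double_code_shadow[OF sc l T])
  then have depD: "depends_on (N - {l}) ?D" unfolding double_code_def by blast
  have depM: "depends_on N M" using sc unfolding single_code_def by blast
  obtain t0 where t0: "T t0" using two_ex[OF T] .
  obtain t1 where t1: "t1 \<noteq> t0" "T t1" using two_ex_neq[OF T] .
  have Tt: "t = t0 \<or> t = t1" if "T t" for t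
    using two_third[OF T t1(1), of t] t0 t1 that by blast
  define ext where "ext U x \<longleftrightarrow> (if \<not> T (x l) then M x else if x l = t0 then U x else ?D x \<and> \<not> U x)"
    for U :: "(nat \<Rightarrow> symb) \<Rightarrow> bool" and x
  have "bij_betw (\<lambda>M' x. M' (x(l := t0))) (completions N M l T) {U. transversal (N - {l}) ?D U}"
  proof (rule bij_betw_byWitness[where f' = ext])
    show "\<forall>M'\<in>completions N M l T. ext (\<lambda>x. M' (x(l := t0))) = M'"
    proof
      fix M' assume M': "M' \<in> completions N M l T"
      then have sc': "single_code N M'" unfolding completions_def by blast
      show "ext (\<lambda>x. M' (x(l := t0))) = M'"
      proof
        fix x
        have uni: "\<exists>!p. M' (x(l := p))" using sc' l unfolding single_code_def by blast
        have triv: "M' (x(l := x l)) = M' x" by simp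
        consider "\<not> T (x l)" | "x l = t0" | "x l = t1" "x l \<noteq> t0" "T (x l)" using Tt by blast
        then show "ext (\<lambda>x. M' (x(l := t0))) x = M' x"
        proof cases
          case 1 then show ?thesis using M' unfolding ext_def completions_def by auto
        next
          case 2 then show ?thesis using t0 triv unfolding ext_def by simp
        next
          case 3
          have "M' x \<longleftrightarrow> shadow M' l T x \<and> \<not> M' (x(l := t0))"
          proof
            assume "M' x"
            then show "shadow M' l T x \<and> \<not> M' (x(l := t0))"
              using uni triv 3 unfolding shadow_def by metis
          next
            assume a: "shadow M' l T x \<and> \<not> M' (x(l := t0))"
            then obtain t where "T t" "M' (x(l := t))" unfolding shadow_def by blast
            then show "M' x" using Tt[of t] a 3(1) triv by metis
          qed
          then show ?thesis using 3 shadow_completion[OF sc l M'] unfolding ext_def by simp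
        qed
      qed
    qed
    show "\<forall>U\<in>{U. transversal (N - {l}) ?D U}. (\<lambda>x. ext U (x(l := t0))) = U"
    proof (intro ballI ext)
      fix U x assume "U \<in> {U. transversal (N - {l}) ?D U}"
      then have "U (x(l := t0)) = U x"
        unfolding transversal_def by (intro depends_onD[of "N - {l}" U]) auto
      then show "ext U (x(l := t0)) = U x" using t0 unfolding ext_def by simp
    qed
    show "(\<lambda>M' x. M' (x(l := t0))) ` completions N M l T \<subseteq> {U. transversal (N - {l}) ?D U}"
      using transversal_of_completion[OF sc l T t0] by blast
    show "ext ` {U. transversal (N - {l}) ?D U} \<subseteq> completions N M l T"
    proof
      fix M' assume "M' \<in> ext ` {U. transversal (N - {l}) ?D U}"
      then obtain U where M': "M' = ext U" and U: "transversal (N - {l}) ?D U" by blast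
      have depU: "depends_on (N - {l}) U" and subU: "\<And>x. U x \<Longrightarrow> ?D x"
        using U unfolding transversal_def by blast+
      have Uc: "transversal (N - {l}) ?D (\<lambda>x. ?D x \<and> \<not> U x)" by (rule transversal_compl[OF depD U])
      have "single_code N M'"
        unfolding single_code_def
      proof (intro conjI ballI allI)
        show "depends_on N M'"
          unfolding depends_on_def
        proof (intro allI impI)
          fix x y :: "nat \<Rightarrow> symb" assume xy: "\<forall>i\<in>N. x i = y i"
          have "M x = M y" using xy by (intro depends_onD[OF depM]) blast
          moreover have "?D x = ?D y" using xy by (intro depends_onD[OF depD]) blast
          moreover have "U x = U y" using xy by (intro depends_onD[OF depU]) blast
          ultimately show "M' x = M' y" using xy l unfolding M' ext_def by simp
        qed
        fix i x assume i: "i \<in> N"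
        have ex1: "\<exists>!p. M (x(i := p))" using sc i unfolding single_code_def by blast
        show "\<exists>!p. M' (x(i := p))"
        proof (cases "i = l")
          case True
          have "U (x(l := p)) = U x" for p
            by (rule depends_onD[OF depU]) auto
          then have e: "M' (x(l := p)) \<longleftrightarrow>
              (if \<not> T p then M (x(l := p)) else if p = t0 then U x else ?D x \<and> \<not> U x)" for p
            unfolding M' ext_def by simp
          show ?thesis
          proof (cases "?D x")
            \<comment> \<open>The prescribed layers contain no codeword on this
              \<open>l\<close>-line, so its codeword is in layer \<open>t0\<close> or
              \<open>t1\<close>, as \<open>U\<close> dictates.\<close>
            case D: True
            then have "\<not> M (x(l := p))" if "\<not> T p" for p
              using that shadow_not[OF sc l, of T x] unfolding shadow_def by blast
            then have "M' (x(l := p)) \<longleftrightarrow> (if U x then p = t0 else p = t1)" for p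
              unfolding e using D Tt t0 t1 by auto
            then show ?thesis unfolding True by auto
          next
            case D: False
            then have "M' (x(l := p)) \<longleftrightarrow> M (x(l := p))" for p
              unfolding e using subU unfolding shadow_def by auto
            then show ?thesis using ex1 unfolding True by simp
          qed
        next
          case False
          then have iI: "i \<in> N - {l}" using i by blast
          have e: "M' (x(i := p)) = (if \<not> T (x l) then M (x(i := p)) else if x l = t0 then U (x(i := p))
              else ?D (x(i := p)) \<and> \<not> U (x(i := p)))" for p
            unfolding M' ext_def using False by simp
          show ?thesis
            unfolding e using ex1 transversal_ex1[OF dc U iI, of x] transversal_ex1[OF dc Uc iI, of x]
            by (cases "T (x l)"; cases "x l = t0") simp_all
        qed
      qed
      then show "M' \<in> completions N M l T" unfolding completions_def M' ext_def by auto
    qed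
  qed
  then show ?thesis by (rule bij_betw_same_card)
qed

section \<open>Quasigroups on lists\<close>

definition enc :: "symb \<Rightarrow> nat" where
  "enc p = (case p of S0 \<Rightarrow> 0 | S1 \<Rightarrow> 1 | S2 \<Rightarrow> 2 | S3 \<Rightarrow> 3)"

definition dec :: "nat \<Rightarrow> symb" where
  "dec y = (if y = 0 then S0 else if y = 1 then S1 else if y = 2 then S2 else S3)"

lemma dec_enc [simp]: "dec (enc p) = p"
  by (cases p) (simp_all add: enc_def dec_def)

lemma enc_dec [simp]: "y \<in> Sig \<Longrightarrow> enc (dec y) = y"
  by (auto simp: Sig_def enc_def dec_def)

lemma enc_in_Sig [simp]: "enc p \<in> Sig"
  by (cases p) (simp_all add: enc_def Sig_def)

lemma enc_eq_iff [simp]: "enc p = enc q \<longleftrightarrow> p = q"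
  by (metis dec_enc)

definition wd :: "nat \<Rightarrow> (nat \<Rightarrow> symb) \<Rightarrow> nat list" where
  "wd n x = map (\<lambda>i. enc (x i)) [0..<n]"

lemma length_wd [simp]: "length (wd n x) = n"
  by (simp add: wd_def)

lemma wd_nth [simp]: "i < n \<Longrightarrow> wd n x ! i = enc (x i)"
  by (simp add: wd_def)

lemma wd_in_words [simp]: "wd n x \<in> words n"
  by (auto simp: wd_def words_def)

lemma words_nth: "w \<in> words n \<Longrightarrow> i < n \<Longrightarrow> w ! i \<in> Sig"
  by (auto simp: words_def)

lemma wd_dec: "w \<in> words n \<Longrightarrow> wd n (\<lambda>i. dec (w ! i)) = w"
  by (rule nth_equalityI) (simp_all add: words_nth, simp add: words_def)

lemma wd_cong: "(\<And>i. i < n \<Longrightarrow> x i = y i) \<Longrightarrow> wd n x = wd n y"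
  by (simp add: wd_def)

lemma wd_upd: "i < n \<Longrightarrow> wd n (x(i := p)) = (wd n x)[i := enc p]"
  by (rule nth_equalityI) (auto simp: nth_list_update)

lemma wd_upd_ge [simp]: "n \<le> i \<Longrightarrow> wd n (x(i := p)) = wd n x"
  by (rule wd_cong) simp

text \<open>Bijectivity in each argument is restated as unique solvability, the form used by
  \<open>single_code\<close> and \<open>latin\<close>.\<close>

lemma is_quasigroup_iff:
  "is_quasigroup n h \<longleftrightarrow> (\<forall>x. h (wd n x) \<in> Sig) \<and>
     (\<forall>i<n. \<forall>x t. \<exists>!p. h (wd n (x(i := p))) = enc t)"
proof
  assume q: "is_quasigroup n h"
  show "(\<forall>x. h (wd n x) \<in> Sig) \<and> (\<forall>i<n. \<forall>x t. \<exists>!p. h (wd n (x(i := p))) = enc t)"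
  proof (intro conjI allI impI)
    show "h (wd n x) \<in> Sig" for x using q unfolding is_quasigroup_def by simp
    fix i x t assume i: "i < n"
    have b: "bij_betw (\<lambda>y. h ((wd n x)[i := y])) Sig Sig"
      using q i unfolding is_quasigroup_def by simp
    have "enc t \<in> (\<lambda>y. h ((wd n x)[i := y])) ` Sig"
      using b unfolding bij_betw_def by simp
    then obtain y where y: "y \<in> Sig" "h ((wd n x)[i := y]) = enc t" by auto
    show "\<exists>!p. h (wd n (x(i := p))) = enc t"
    proof (rule ex1I[of _ "dec y"])
      show "h (wd n (x(i := dec y))) = enc t" using y by (simp add: wd_upd[OF i])
      fix p assume "h (wd n (x(i := p))) = enc t"
      then have "h ((wd n x)[i := enc p]) = h ((wd n x)[i := y])" using y by (simp add: wd_upd[OF i])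
      then have "enc p = y" using b y(1) unfolding bij_betw_def inj_on_def by simp
      then show "p = dec y" by auto
    qed
  qed
next
  assume a: "(\<forall>x. h (wd n x) \<in> Sig) \<and> (\<forall>i<n. \<forall>x t. \<exists>!p. h (wd n (x(i := p))) = enc t)"
  show "is_quasigroup n h"
    unfolding is_quasigroup_def
  proof (intro conjI ballI allI impI)
    show "h w \<in> Sig" if "w \<in> words n" for w using a wd_dec[OF that] by metis
    fix i w assume i: "i < n" and w: "w \<in> words n"
    define x where "x = (\<lambda>i. dec (w ! i))"
    have e: "w[i := y] = wd n (x(i := dec y))" if "y \<in> Sig" for y
      using wd_dec[OF w] that by (simp add: wd_upd[OF i] x_def)
    have u: "\<exists>!p. h (wd n (x(i := p))) = enc t" for t using a i by blast
    show "bij_betw (\<lambda>y. h (w[i := y])) Sig Sig"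
    proof (rule bij_betwI')
      fix y z assume yz: "y \<in> Sig" "z \<in> Sig"
      have "dec y = dec z" if "h (w[i := y]) = h (w[i := z])"
      proof -
        have "h (w[i := y]) = enc (dec (h (w[i := y])))" using a e[OF yz(1)] by simp
        then show ?thesis using u[of "dec (h (w[i := y]))"] that e yz by metis
      qed
      then show "(h (w[i := y]) = h (w[i := z])) = (y = z)" using yz by (metis enc_dec)
    next
      fix y assume "y \<in> Sig" then show "h (w[i := y]) \<in> Sig" using a e by simp
    next
      fix z assume z: "z \<in> Sig"
      obtain p where "h (wd n (x(i := p))) = enc (dec z)" using u by blast
      then have "z = h (w[i := enc p])" using z e[of "enc p"] by simp
      then show "\<exists>y\<in>Sig. z = h (w[i := y])" by (rule bexI) simp
    qed
  qed
qed

section \<open>Graphs of quasigroups\<close>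

text \<open>Coordinates below \<open>n\<close> are the arguments and coordinate \<open>n\<close> is
  the value, so the last argument has index \<open>n - 1\<close>.\<close>

definition graph :: "nat \<Rightarrow> (nat list \<Rightarrow> nat) \<Rightarrow> (nat \<Rightarrow> symb) \<Rightarrow> bool" where
  "graph n h x \<longleftrightarrow> h (wd n x) = enc (x n)"

lemma single_code_graph:
  assumes q: "is_quasigroup n h" shows "single_code {0..n} (graph n h)"
  unfolding single_code_def
proof (intro conjI ballI allI)
  show "depends_on {0..n} (graph n h)"
    unfolding depends_on_def
  proof (intro allI impI)
    fix x y :: "nat \<Rightarrow> symb" assume xy: "\<forall>i\<in>{0..n}. x i = y i"
    then have "wd n x = wd n y" by (intro wd_cong) simp
    then show "graph n h x = graph n h y" using xy unfolding graph_def by simp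
  qed
  fix i x assume i: "i \<in> {0..n}"
  show "\<exists>!p. graph n h (x(i := p))"
  proof (cases "i = n")
    case True
    have "h (wd n x) = enc (dec (h (wd n x)))" using q unfolding is_quasigroup_iff by simp
    then show ?thesis unfolding graph_def True by (intro ex1I[of _ "dec (h (wd n x))"]) auto
  next
    case False
    then show ?thesis using q i unfolding is_quasigroup_iff graph_def by simp
  qed
qed

lemma quasigroup_of_single_code:
  assumes sc: "single_code {0..n} M"
  obtains f where "is_quasigroup n f" "\<And>x t. f (wd n x) = enc t \<longleftrightarrow> M (x(n := t))"
proof -
  define f where "f w = enc (THE y. M ((\<lambda>i. dec (w ! i))(n := y)))" for w
  have dep: "depends_on {0..n} M" using sc unfolding single_code_def by blast
  have ex1: "\<exists>!p. M (x(i := p))" if "i \<le> n" for i x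
    using sc that unfolding single_code_def by simp
  have "M ((\<lambda>i. dec (wd n x ! i))(n := y)) = M (x(n := y))" for x y
    by (rule depends_onD[OF dep]) auto
  then have fx: "f (wd n x) = enc (THE y. M (x(n := y)))" for x unfolding f_def by simp
  have f: "f (wd n x) = enc t \<longleftrightarrow> M (x(n := t))" for x t
    unfolding fx enc_eq_iff using ex1[of n x] theI'[OF ex1[of n x]] by blast
  have "is_quasigroup n f"
    unfolding is_quasigroup_iff
  proof (intro conjI allI impI)
    show "f (wd n x) \<in> Sig" for x unfolding fx by simp
    fix i t and x :: "nat \<Rightarrow> symb" assume i: "i < n"
    have "x(i := p, n := t) = x(n := t, i := p)" for p using i by (simp add: fun_upd_twist)
    then show "\<exists>!p. f (wd n (x(i := p))) = enc t" unfolding f using ex1[of i "x(n := t)"] i by simp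
  qed
  then show ?thesis using that f by blast
qed

text \<open>Members of \<open>Qset\<close> are \<open>undefined\<close> off \<open>words n\<close>
  and hence determined by their graphs. The free layers are the two symbols outside
  \<open>{a, b}\<close>.\<close>

lemma bij_betw_Qset_completions:
  assumes n: "1 \<le> n" and q: "is_quasigroup n h"
  shows "bij_betw (graph n) (Qset n h a b)
    (completions {0..n} (graph n h) (n - 1) (\<lambda>t. enc t \<notin> {a, b}))"
  unfolding bij_betw_def
proof
  let ?r = "\<lambda>f x. if x \<in> words n then f x else (undefined :: nat)"
  let ?C = "completions {0..n} (graph n h) (n - 1) (\<lambda>t. enc t \<notin> {a, b})"
  have gr: "graph n (?r f) = graph n f" for f by (simp add: graph_def[abs_def])
  show "inj_on (graph n) (Qset n h a b)"
  proof (rule inj_onI)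
    fix g g' assume "g \<in> Qset n h a b" "g' \<in> Qset n h a b" and e: "graph n g = graph n g'"
    then obtain f f' where f: "g = ?r f" "is_quasigroup n f" and f': "g' = ?r f'" "is_quasigroup n f'"
      unfolding Qset_def by blast
    have "f w = f' w" if w: "w \<in> words n" for w
    proof -
      let ?x = "\<lambda>i. dec (w ! i)"
      have fw: "f w = enc (dec (f w))" using f(2) w unfolding is_quasigroup_def by simp
      have "graph n f (?x(n := dec (f w)))"
        unfolding graph_def using wd_dec[OF w] fw by simp
      then have "graph n f' (?x(n := dec (f w)))" using e f f' gr by metis
      then show ?thesis unfolding graph_def using wd_dec[OF w] fw by simp
    qed
    then show "g = g'" unfolding f(1) f'(1) by auto
  qed
  show "graph n ` Qset n h a b = ?C"
  proof
    show "graph n ` Qset n h a b \<subseteq> ?C"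
    proof
      fix M assume "M \<in> graph n ` Qset n h a b"
      then obtain f where M: "M = graph n f" and f: "is_quasigroup n f"
        and ag: "\<And>w. w \<in> words n \<Longrightarrow> w ! (n - 1) \<in> {a, b} \<Longrightarrow> f w = h w"
        unfolding Qset_def using gr by auto
      have "graph n f x = graph n h x" if "enc (x (n - 1)) \<in> {a, b}" for x
        unfolding graph_def using ag[of "wd n x"] that n by simp
      then show "M \<in> ?C" unfolding completions_def M using single_code_graph[OF f] by auto
    qed
    show "?C \<subseteq> graph n ` Qset n h a b"
    proof
      fix M assume M: "M \<in> ?C"
      then have sc: "single_code {0..n} M" unfolding completions_def by blast
      obtain f where f: "is_quasigroup n f" "\<And>x t. f (wd n x) = enc t \<longleftrightarrow> M (x(n := t))"
        using quasigroup_of_single_code[OF sc] by blast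
      have "f w = h w" if w: "w \<in> words n" "w ! (n - 1) \<in> {a, b}" for w
      proof -
        let ?x = "\<lambda>i. dec (w ! i)"
        have hw: "h w = enc (dec (h w))" using q w(1) unfolding is_quasigroup_def by simp
        have "n - 1 \<noteq> n" using n by simp
        then have "enc ((?x(n := dec (h w))) (n - 1)) \<in> {a, b}"
          using w n words_nth[OF w(1), of "n - 1"] by simp
        then have "M (?x(n := dec (h w))) = graph n h (?x(n := dec (h w)))"
          using M unfolding completions_def by blast
        also have "\<dots>" unfolding graph_def using wd_dec[OF w(1)] hw by simp
        finally have "f (wd n ?x) = enc (dec (h w))" using f(2) by blast
        then show ?thesis using wd_dec[OF w(1)] hw by simp
      qed
      then have mem: "?r f \<in> Qset n h a b" unfolding Qset_def using f(1) by blast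
      have "graph n (?r f) = M"
        unfolding gr by (rule ext) (simp add: graph_def f(2))
      then show "M \<in> graph n ` Qset n h a b" using imageI[OF mem, of "graph n"] by (simp only:)
    qed
  qed
qed

section \<open>Codes as sets of words and semilinearity\<close>

definition word_set :: "nat \<Rightarrow> ((nat \<Rightarrow> symb) \<Rightarrow> bool) \<Rightarrow> nat list set" where
  "word_set m P = {wd m x | x. P x}"

lemma wd_in_word_set:
  assumes "depends_on {0..<m} P" shows "wd m x \<in> word_set m P \<longleftrightarrow> P x"
proof
  assume "wd m x \<in> word_set m P"
  then obtain y where y: "wd m x = wd m y" "P y" unfolding word_set_def by blast
  have "x i = y i" if "i < m" for i
    using wd_nth[OF that, of x] wd_nth[OF that, of y] y(1) by simp
  then show "P x" using depends_onD[OF assms, of x y] y by simp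
qed (auto simp: word_set_def)

lemma card_word_set_line:
  assumes dep: "depends_on {0..<m} P" and i: "i < m"
  shows "card (word_set m P \<inter> line m i (wd m x)) = card {p. P (x(i := p))}"
proof -
  have inj: "inj_on (\<lambda>p. wd m (x(i := p))) {p. P (x(i := p))}"
  proof (rule inj_onI)
    fix p q assume "wd m (x(i := p)) = wd m (x(i := q))"
    then have "wd m (x(i := p)) ! i = wd m (x(i := q)) ! i" by simp
    then show "p = q" using i by simp
  qed
  have "line m i (wd m x) = range (\<lambda>p. wd m (x(i := p)))"
  proof -
    have "(wd m x)[i := y] = wd m (x(i := dec y))" if "y \<in> Sig" for y
      using that by (simp add: wd_upd[OF i])
    moreover have "wd m (x(i := p)) = (wd m x)[i := enc p]" for p by (rule wd_upd[OF i])
    ultimately show ?thesis unfolding line_def using enc_in_Sig by blast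
  qed
  then have "word_set m P \<inter> line m i (wd m x) = (\<lambda>p. wd m (x(i := p))) ` {p. P (x(i := p))}"
    using wd_in_word_set[OF dep] by auto
  then show ?thesis using card_image[OF inj] by simp
qed

lemma word_set_lines:
  assumes "depends_on {0..<m} P" "\<And>i x. i < m \<Longrightarrow> card {p. P (x(i := p))} = c"
  shows "word_set m P \<subseteq> words m \<and> (\<forall>l\<in>lines m. card (word_set m P \<inter> l) = c)"
proof
  show "word_set m P \<subseteq> words m" unfolding word_set_def by auto
  have "card (word_set m P \<inter> line m i w) = c" if "i < m" "w \<in> words m" for i w
    using card_word_set_line[OF assms(1) that(1), of "\<lambda>i. dec (w ! i)"] wd_dec[OF that(2)]
      assms(2)[OF that(1)] by simp
  then show "\<forall>l\<in>lines m. card (word_set m P \<inter> l) = c" unfolding lines_def by auto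
qed

text \<open>The shadow is linear on \<open>n\<close> coordinates. Combining its linear form with
  \<open>T\<close> at the deleted coordinate gives a linear double code on all \<open>n + 1\<close>
  coordinates, and \<open>shadow_iff\<close> puts the graph inside it.\<close>

lemma semilinear_if_flat:
  assumes n: "1 \<le> n" and q: "is_quasigroup n h" and T: "two T"
    and fl: "\<And>i j. i \<in> {0..n} - {n - 1} \<Longrightarrow> j \<in> {0..n} - {n - 1} \<Longrightarrow> i \<noteq> j \<Longrightarrow>
      flat (shadow (graph n h) (n - 1) T) i j"
  shows "semilinear n h"
proof -
  let ?l = "n - 1" and ?N = "{0..n}" and ?M = "graph n h"
  let ?I = "?N - {?l}" and ?D = "shadow ?M ?l T"
  have sc: "single_code ?N ?M" by (rule single_code_graph[OF q])
  have l: "?l \<in> ?N" by simp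
  have N: "{0..<Suc n} = ?N" by auto
  have depM: "depends_on {0..<Suc n} ?M" using sc unfolding single_code_def N by blast
  have dc: "double_code ?I ?D" by (rule double_code_shadow[OF sc l T])
  then have depD: "depends_on ?I ?D" unfolding double_code_def by blast
  define E where "E x \<longleftrightarrow> (?D x \<longleftrightarrow> T (x ?l))" for x
  have depE: "depends_on {0..<Suc n} E"
    unfolding depends_on_def N
  proof (intro allI impI)
    fix x y :: "nat \<Rightarrow> symb" assume xy: "\<forall>i\<in>?N. x i = y i"
    then have "?D x = ?D y" by (intro depends_onD[OF depD]) blast
    moreover have "x ?l = y ?l" using xy l by blast
    ultimately show "E x = E y" unfolding E_def by simp
  qed
  have twoE: "two (\<lambda>p. E (x(i := p)))" if i: "i < Suc n" for i x
  proof (cases "i = ?l")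
    case True
    then show ?thesis using two_iff_const[OF T, of "?D x"] unfolding E_def by (simp add: eq_commute)
  next
    case False
    then have "two (\<lambda>p. ?D (x(i := p)))" using dc i unfolding double_code_def by simp
    from two_iff_const[OF this, of "T (x ?l)"] show ?thesis using False unfolding E_def by simp
  qed
  have MDS: "MDS_code (Suc n) (word_set (Suc n) ?M)"
    unfolding MDS_code_def
  proof (rule word_set_lines[OF depM])
    fix i x assume "i < Suc n"
    then have "\<exists>!p. ?M (x(i := p))" using sc unfolding single_code_def by simp
    then obtain q where "{p. ?M (x(i := p))} = {q}" by auto
    then show "card {p. ?M (x(i := p))} = 1" by simp
  qed
  have dMDS: "double_MDS_code (Suc n) (word_set (Suc n) E)"
    unfolding double_MDS_code_def
    by (rule word_set_lines[OF depE]) (use twoE in \<open>simp add: two_def\<close>)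
  define x0 :: "nat \<Rightarrow> symb" where "x0 = (\<lambda>_. S0)"
  \<comment> \<open>The constant \<open>?D x0\<close> of the linear form is absorbed into the
    summand of the deleted coordinate \<open>n - 1\<close>.\<close>
  define \<chi> :: "nat \<Rightarrow> nat \<Rightarrow> nat" where
    "\<chi> i y = (if i = ?l then of_bool (?D x0 \<longleftrightarrow> T (dec y)) else of_bool (?D (x0(i := dec y)) \<noteq> ?D x0))" for i y
  have lin: "E x \<longleftrightarrow> (\<Sum>i<Suc n. \<chi> i (enc (x i))) mod 2 = 1" for x
  proof -
    define s where "s = (\<Sum>i\<in>?I. of_bool (?D (x0(i := x i)) \<noteq> ?D x0) :: nat)"
    have "(\<Sum>i<Suc n. \<chi> i (enc (x i))) = (\<Sum>i\<in>?N. \<chi> i (enc (x i)))"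
      by (rule sum.cong) auto
    also have "\<dots> = \<chi> ?l (enc (x ?l)) + (\<Sum>i\<in>?I. \<chi> i (enc (x i)))"
      by (rule sum.remove) auto
    also have "(\<Sum>i\<in>?I. \<chi> i (enc (x i))) = s"
      unfolding s_def by (rule sum.cong) (auto simp: \<chi>_def)
    also have "\<chi> ?l (enc (x ?l)) = of_bool (?D x0 \<longleftrightarrow> T (x ?l))" by (simp add: \<chi>_def)
    finally have e: "(\<Sum>i<Suc n. \<chi> i (enc (x i))) = of_bool (?D x0 \<longleftrightarrow> T (x ?l)) + s" .
    have "odd (\<Sum>i<Suc n. \<chi> i (enc (x i))) \<longleftrightarrow> (even s \<longleftrightarrow> (?D x0 \<longleftrightarrow> T (x ?l)))"
      unfolding e by simp
    moreover have "?D x \<longleftrightarrow> (?D x0 \<longleftrightarrow> even s)"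
      unfolding s_def by (rule flat_imp_linear[OF _ depD fl]) auto
    ultimately show ?thesis unfolding E_def odd_iff_mod_2_eq_one[symmetric] by argo
  qed
  have "linear_double_MDS_code (Suc n) (word_set (Suc n) E)"
    unfolding linear_double_MDS_code_def
  proof (intro conjI exI[of _ \<chi>] allI impI ballI)
    show "\<chi> i y \<in> {0, 1}" for i y unfolding \<chi>_def by simp
    fix w assume w: "w \<in> words (Suc n)"
    let ?x = "\<lambda>i. dec (w ! i)"
    have "w \<in> word_set (Suc n) E \<longleftrightarrow> E ?x" using wd_in_word_set[OF depE, of ?x] wd_dec[OF w] by simp
    also have "\<dots> \<longleftrightarrow> (\<Sum>i<Suc n. \<chi> i (enc (?x i))) mod 2 = 1" by (rule lin)
    also have "(\<Sum>i<Suc n. \<chi> i (enc (?x i))) = (\<Sum>i<Suc n. \<chi> i (w ! i))"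
      by (rule sum.cong) (use words_nth[OF w] in auto)
    finally show "w \<in> word_set (Suc n) E \<longleftrightarrow> (\<Sum>i<Suc n. \<chi> i (w ! i)) mod 2 = 1" .
  qed (rule dMDS)
  moreover have "word_set (Suc n) ?M \<subseteq> word_set (Suc n) E"
    unfolding word_set_def E_def using shadow_iff[OF sc l] by blast
  moreover have "{x @ [h x] | x. x \<in> words n} = word_set (Suc n) ?M"
  proof
    show "{x @ [h x] | x. x \<in> words n} \<subseteq> word_set (Suc n) ?M"
    proof clarify
      fix w assume w: "w \<in> words n"
      let ?x = "(\<lambda>i. dec (w ! i))(n := dec (h w))"
      have wx: "wd n ?x = w" using wd_dec[OF w] by simp
      have hw: "enc (dec (h w)) = h w" using q w unfolding is_quasigroup_def by simp
      have "wd (Suc n) ?x = w @ [h w]" using wx hw by (simp add: wd_def)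
      moreover have "?M ?x" unfolding graph_def wx using hw by simp
      ultimately show "w @ [h w] \<in> word_set (Suc n) ?M" unfolding word_set_def by force
    qed
    show "word_set (Suc n) ?M \<subseteq> {x @ [h x] | x. x \<in> words n}"
    proof
      fix w assume "w \<in> word_set (Suc n) ?M"
      then obtain x where x: "w = wd (Suc n) x" "h (wd n x) = enc (x n)"
        unfolding word_set_def graph_def by blast
      then have "w = wd n x @ [h (wd n x)]" by (simp add: wd_def)
      then show "w \<in> {x @ [h x] | x. x \<in> words n}" using wd_in_words by blast
    qed
  qed
  ultimately show ?thesis unfolding semilinear_def semilinear_code_def using MDS by auto
qed

section \<open>Reducibility from a split equation\<close>

text \<open>Spreads the entries of \<open>u\<close> over the coordinates listed in
  \<open>ks\<close>. The default \<open>S0\<close> elsewhere is invisible to functions depending on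
  \<open>set ks\<close> only.\<close>

definition assignment :: "nat list \<Rightarrow> nat list \<Rightarrow> nat \<Rightarrow> symb" where
  "assignment ks u i = (case map_of (zip ks u) i of Some y \<Rightarrow> dec y | None \<Rightarrow> S0)"

lemma assignment_map: "i \<in> set ks \<Longrightarrow> assignment ks (map f ks) i = dec (f i)"
  by (simp add: assignment_def map_of_zip_map)

lemma assignment_upd:
  assumes "distinct ks" "length u = length ks" "m < length ks"
  shows "assignment ks (u[m := enc p]) = (assignment ks u)(ks ! m := p)"
proof
  fix i
  show "assignment ks (u[m := enc p]) i = ((assignment ks u)(ks ! m := p)) i"
  proof (cases "i \<in> set ks")
    case True
    then obtain j where j: "j < length ks" "i = ks ! j" by (metis in_set_conv_nth)
    show ?thesis unfolding j(2) assignment_def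
      using assms j(1) by (auto simp: map_of_zip_nth nth_eq_iff_index_eq)
  next
    case False
    then have "map_of (zip ks (u[m := enc p])) i = None" "map_of (zip ks u) i = None"
      using assms by (simp_all add: map_of_zip_is_None)
    then show ?thesis using False assms(3) unfolding assignment_def by auto
  qed
qed

lemma nths_eq_map_nth: "nths w A = map ((!) w) (filter (\<lambda>i. i \<in> A) [0..<length w])"
proof (induction w rule: rev_induct)
  case (snoc y w)
  have "map ((!) (w @ [y])) (filter (\<lambda>i. i \<in> A) [0..<length w]) = map ((!) w) (filter (\<lambda>i. i \<in> A) [0..<length w])"
    by (auto simp: nth_append)
  then show ?case using snoc by (simp add: nths_append)
qed simp

lemma filter_eq_upt: "k < n \<Longrightarrow> filter (\<lambda>i. i = k) [0..<n] = [k]"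
  by (induction n) (auto simp: less_Suc_eq filter_empty_conv)

lemma quasigroup_assignment:
  assumes lat: "latin K \<phi>" and ks: "distinct ks" "set ks = K"
  shows "is_quasigroup (card K) (\<lambda>u. enc (\<phi> (assignment ks u)))"
  unfolding is_quasigroup_iff
proof (intro conjI allI impI)
  have len: "length ks = card K" using distinct_card[OF ks(1)] ks(2) by simp
  fix i x t assume i: "i < card K"
  have "ks ! i \<in> K" using i len ks(2) nth_mem by metis
  then have "\<exists>!p. \<phi> ((assignment ks (wd (card K) x))(ks ! i := p)) = t"
    using lat unfolding latin_def by blast
  then show "\<exists>!p. enc (\<phi> (assignment ks (wd (card K) (x(i := p))))) = enc t"
    unfolding wd_upd[OF i] enc_eq_iff using assignment_upd[OF ks(1), of "wd (card K) x" i] i len by simp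
qed simp

lemma quasigroup_hd: "is_quasigroup (Suc 0) hd"
  unfolding is_quasigroup_iff by (auto simp: wd_def)

text \<open>The outer quasigroup of the decomposition: the head of \<open>w\<close> is the value of
  the inner one, the tail gives the arguments at \<open>ls\<close>, and the result is the value of
  coordinate \<open>n\<close> that satisfies the equation.\<close>

definition solve :: "((nat \<Rightarrow> symb) \<Rightarrow> symb) \<Rightarrow> nat list \<Rightarrow> nat \<Rightarrow> nat list \<Rightarrow> nat" where
  "solve \<gamma> ls n w = enc (THE y. \<gamma> ((assignment ls (tl w))(n := y)) = dec (hd w))"

lemma quasigroup_solve:
  assumes lat: "latin L \<gamma>" and ls: "distinct ls" "set ls = L - {n}" and n: "n \<in> L"
  shows "is_quasigroup (Suc (length ls)) (solve \<gamma> ls n)"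
    and "\<And>w t. solve \<gamma> ls n w = enc t \<longleftrightarrow> \<gamma> ((assignment ls (tl w))(n := t)) = dec (hd w)"
proof -
  let ?f0 = "solve \<gamma> ls n"
  have ex1: "\<exists>!y. \<gamma> (x(i := y)) = t" if "i \<in> L" for i x t
    using lat that unfolding latin_def by blast
  show f0: "?f0 w = enc t \<longleftrightarrow> \<gamma> ((assignment ls (tl w))(n := t)) = dec (hd w)" for w t
    unfolding solve_def enc_eq_iff using ex1[OF n] theI'[OF ex1[OF n]] by metis
  show "is_quasigroup (Suc (length ls)) ?f0"
    unfolding is_quasigroup_iff
  proof (intro conjI allI impI)
    show "?f0 (wd (Suc (length ls)) x) \<in> Sig" for x unfolding solve_def by simp
    fix i x t assume i: "i < Suc (length ls)"
    obtain v vs where w: "wd (Suc (length ls)) x = v # vs" "length vs = length ls"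
      by (metis length_wd length_Suc_conv)
    show "\<exists>!p. ?f0 (wd (Suc (length ls)) (x(i := p))) = enc t"
    proof (cases i)
      case 0
      then have "wd (Suc (length ls)) (x(i := p)) = enc p # vs" for p
        using wd_upd[OF i, of x p] w by simp
      then show ?thesis unfolding f0 by simp
    next
      case (Suc j)
      then have j: "j < length ls" using i by simp
      then have "ls ! j \<in> L" "ls ! j \<noteq> n" using ls(2) nth_mem by blast+
      then have "(assignment ls vs)(ls ! j := p, n := t) = (assignment ls vs)(n := t, ls ! j := p)" for p
        by (simp add: fun_upd_twist)
      moreover have "wd (Suc (length ls)) (x(i := p)) = v # vs[j := enc p]" for p
        using wd_upd[OF i, of x p] w Suc by simp
      ultimately show ?thesis
        unfolding f0
        using ex1[OF \<open>ls ! j \<in> L\<close>, of "(assignment ls vs)(n := t)" "dec v"]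
        by (simp add: assignment_upd[OF ls(1) w(2) j])
    qed
  qed
qed

text \<open>Solving \<open>\<phi> x = \<gamma> x\<close> for coordinate \<open>n\<close> expresses
  \<open>h\<close> through the value of \<open>\<phi>\<close> and the remaining single arguments in
  \<open>L\<close>. The blocks are \<open>K\<close> and these singletons, on which the unary
  quasigroup \<open>hd\<close> acts.\<close>

lemma reducible_if_split:
  assumes q: "is_quasigroup n h" and KL: "K \<union> L = {0..n}" "K \<inter> L = {}" and n: "n \<in> L"
    and cK: "2 \<le> card K" and cL: "2 \<le> card L" and phi: "latin K \<phi>" and gam: "latin L \<gamma>"
    and split: "\<And>x. graph n h x \<longleftrightarrow> \<phi> x = \<gamma> x"
  shows "reducible n h"
proof -
  define ks where "ks = filter (\<lambda>i. i \<in> K) [0..<n]"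
  define ls where "ls = filter (\<lambda>i. i \<in> L) [0..<n]"
  have Kn: "K \<subseteq> {0..<n}"
  proof
    fix i assume "i \<in> K"
    then have "i \<in> {0..n}" "i \<noteq> n" using KL n by blast+
    then show "i \<in> {0..<n}" by simp
  qed
  have ks: "distinct ks" "set ks = K" using Kn by (auto simp: ks_def)
  have Ln: "L - {n} \<subseteq> {0..<n}"
  proof
    fix i assume "i \<in> L - {n}"
    then have "i \<in> {0..n}" "i \<noteq> n" using KL by blast+
    then show "i \<in> {0..<n}" by simp
  qed
  have ls: "distinct ls" "set ls = L - {n}" using Ln by (auto simp: ls_def)
  have finKL: "finite K" "finite L" using KL(1) by (metis finite_Un finite_atLeastAtMost)+
  \<comment> \<open>The value coordinate \<open>n\<close> counts in \<open>L\<close> but belongs to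
    no block. Together with block \<open>K\<close> there are \<open>card L\<close> blocks, and
    \<open>2 \<le> card K\<close> keeps their number at most \<open>n - 1\<close>.\<close>
  have "card K + card L = Suc n" using card_Un_disjoint[OF finKL KL(2)] KL(1) by simp
  moreover have "length ls = card L - 1"
    using distinct_card[OF ls(1)] ls(2) card_Diff_singleton[OF n] by simp
  ultimately have len: "Suc (length ls) = card L" "card L \<le> n - 1" using cK cL by linarith+
  define P where "P j = (case j of 0 \<Rightarrow> K | Suc m \<Rightarrow> {ls ! m})" for j
  define fs where "fs j = (case j of 0 \<Rightarrow> (\<lambda>u. enc (\<phi> (assignment ks u))) | Suc m \<Rightarrow> hd)" for j :: nat
  let ?f0 = "solve \<gamma> ls n"
  note f0 = quasigroup_solve[OF gam ls n]
  have ls_mem: "ls ! m \<in> L" "ls ! m \<noteq> n" "ls ! m < n" if "m < length ls" for m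
    using nth_mem[OF that] ls(2) Ln by auto
  show ?thesis
    unfolding reducible_def
  proof (intro exI[of _ "Suc (length ls)"] exI[of _ P] exI[of _ ?f0] exI[of _ fs] conjI)
    show "2 \<le> Suc (length ls)" "Suc (length ls) \<le> n - 1" using len cL by simp_all
    show "\<forall>j<Suc (length ls). P j \<noteq> {}" using cK by (auto simp: P_def split: nat.split)
    show "\<forall>j<Suc (length ls). \<forall>j'<Suc (length ls). j \<noteq> j' \<longrightarrow> P j \<inter> P j' = {}"
    proof (intro allI impI)
      fix j j' assume j: "j < Suc (length ls)" "j' < Suc (length ls)" "j \<noteq> j'"
      have a: "ls ! m \<notin> K" if "m < length ls" for m using ls_mem[OF that] KL(2) by blast
      show "P j \<inter> P j' = {}"
        using j a ls(1) by (cases j; cases j') (auto simp: P_def nth_eq_iff_index_eq)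
    qed
    have "(\<Union>j<Suc (length ls). P j) = K \<union> (\<Union>m<length ls. {ls ! m})"
      unfolding lessThan_Suc_eq_insert_0 by (simp add: P_def)
    also have "(\<Union>m<length ls. {ls ! m}) = set ls" by (auto simp: set_conv_nth)
    also have "K \<union> set ls = {0..n} - {n}" using KL n unfolding ls(2) by blast
    also have "\<dots> = {0..<n}" by auto
    finally show "(\<Union>j<Suc (length ls). P j) = {0..<n}" .
    show "is_quasigroup (Suc (length ls)) ?f0" by (rule f0)
    show "\<forall>j<Suc (length ls). is_quasigroup (card (P j)) (fs j)"
      using quasigroup_assignment[OF phi ks] quasigroup_hd
      by (auto simp: P_def fs_def split: nat.split)
    show "\<forall>w\<in>words n. h w = ?f0 (map (\<lambda>j. fs j (nths w (P j))) [0..<Suc (length ls)])"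
    proof
      fix w assume w: "w \<in> words n"
      then have lw: "length w = n" by (simp add: words_def)
      let ?x = "\<lambda>i. dec (w ! i)"
      let ?v = "map (\<lambda>j. fs j (nths w (P j))) [0..<Suc (length ls)]"
      have "fs (Suc m) (nths w (P (Suc m))) = w ! (ls ! m)" if "m < length ls" for m
      proof -
        have "nths w {ls ! m} = [w ! (ls ! m)]"
          using ls_mem(3)[OF that] by (simp add: nths_eq_map_nth lw filter_eq_upt)
        then show ?thesis by (simp add: fs_def P_def)
      qed
      then have "map (\<lambda>m. fs (Suc m) (nths w (P (Suc m)))) [0..<length ls] = map ((!) w) ls"
        by (intro nth_equalityI) simp_all
      then have v: "?v = enc (\<phi> (assignment ks (map ((!) w) ks))) # map ((!) w) ls"
        unfolding upt_conv_Cons[OF zero_less_Suc] map_Suc_upt[symmetric]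
        by (simp add: comp_def fs_def P_def nths_eq_map_nth lw ks_def)
      define t where "t = dec (h w)"
      have hw: "h w = enc t" using q w unfolding is_quasigroup_def t_def by simp
      have "graph n h (?x(n := t))" unfolding graph_def using wd_dec[OF w] hw by simp
      then have "\<phi> (?x(n := t)) = \<gamma> (?x(n := t))" using split by blast
      moreover have "\<phi> (assignment ks (map ((!) w) ks)) = \<phi> (?x(n := t))"
      proof (rule depends_onD[of K \<phi>])
        show "depends_on K \<phi>" using phi unfolding latin_def by blast
        fix i assume "i \<in> K"
        moreover from this have "i \<noteq> n" using Kn by auto
        ultimately show "assignment ks (map ((!) w) ks) i = (?x(n := t)) i"
          using ks(2) by (simp add: assignment_map)
      qed
      moreover have "\<gamma> ((assignment ls (map ((!) w) ls))(n := t)) = \<gamma> (?x(n := t))"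
      proof (rule depends_onD[of L \<gamma>])
        show "depends_on L \<gamma>" using gam unfolding latin_def by blast
        fix i assume "i \<in> L"
        then show "((assignment ls (map ((!) w) ls))(n := t)) i = (?x(n := t)) i"
          using ls(2) by (simp add: assignment_map)
      qed
      ultimately have "?f0 ?v = enc t" unfolding f0(2) v by simp
      then show "h w = ?f0 ?v" using hw by simp
    qed
  qed
qed

theorem theorem5:
  fixes n :: nat and h :: "nat list \<Rightarrow> nat" and a b :: nat
  assumes "1 \<le> n"
    and "is_quasigroup n h"
    and "a \<in> Sig" and "b \<in> Sig" and "a \<noteq> b"
  shows "(2 < card (Qset n h a b) \<and> card (Qset n h a b) < 2 ^ (2 ^ (n - 1)) \<longrightarrow> reducible n h)
       \<and> (card (Qset n h a b) = 2 ^ (2 ^ (n - 1)) \<longrightarrow> semilinear n h)"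
proof -
  let ?N = "{0..n}" and ?l = "n - 1" and ?M = "graph n h"
  let ?I = "?N - {?l}"
  define T where "T t \<longleftrightarrow> enc t \<notin> {a, b}" for t
  let ?D = "shadow ?M ?l T"
  have "two (\<lambda>t. t = dec a \<or> t = dec b)"
  proof -
    have "dec a \<noteq> dec b" using assms(3-5) by (metis enc_dec)
    moreover have "Collect (\<lambda>t. t = dec a \<or> t = dec b) = {dec a, dec b}" by auto
    ultimately show ?thesis unfolding two_def by simp
  qed
  moreover have "T t \<longleftrightarrow> \<not> (t = dec a \<or> t = dec b)" for t
    using assms(3,4) unfolding T_def by auto
  ultimately have T: "two T" using two_not[of "\<lambda>t. t = dec a \<or> t = dec b"] by presburger
  have sc: "single_code ?N ?M" by (rule single_code_graph[OF assms(2)])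
  have l: "?l \<in> ?N" by simp
  have nI: "n \<in> ?I" using assms(1) by simp
  have dc: "double_code ?I ?D" by (rule double_code_shadow[OF sc l T])
  have card_I: "card ?I = n" using card_Diff_singleton[OF l] by simp
  have card_Q: "card (Qset n h a b) = card {U. transversal ?I ?D U}"
    using bij_betw_same_card[OF bij_betw_Qset_completions[OF assms(1,2), of a b]]
      card_completions[OF sc l T] unfolding T_def[abs_def] by simp
  have finI: "finite ?I" by simp
  show ?thesis
  proof (intro conjI impI)
    assume Q: "2 < card (Qset n h a b) \<and> card (Qset n h a b) < 2 ^ (2 ^ (n - 1))"
    \<comment> \<open>A connected code would have at most two transversals.\<close>
    have disc: "\<not> connected_code ?I ?D"
      using card_transversals_connected[OF dc _ nI] Q card_Q by linarith
    have "{U. transversal ?I ?D U} \<noteq> {}" using Q card_Q by (metis card.empty not_less_zero)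
    then obtain U where U: "transversal ?I ?D U" by blast
    \<comment> \<open>If every pair were flat, the existing transversal \<open>U\<close> would
      generate at least \<open>2 ^ (2 ^ (n - 1))\<close> of them.\<close>
    have "\<exists>i\<in>?I. \<exists>j\<in>?I. i \<noteq> j \<and> \<not> flat ?D i j"
    proof (rule ccontr)
      assume "\<not> ?thesis"
      then have "2 ^ (2 ^ (card ?I - 1)) \<le> card {U. transversal ?I ?D U}"
        by (intro card_transversals_flat[OF finI dc U _ nI]) blast
      then show False using Q card_Q card_I by simp
    qed
    then obtain i j where ij: "i \<in> ?I" "j \<in> ?I" "i \<noteq> j" "\<not> flat ?D i j" by blast
    obtain K k \<phi> \<gamma> where K: "K \<subseteq> ?I" "i \<in> K" "j \<in> K" "k \<in> ?I - K"
      "latin K \<phi>" "latin (?N - K) \<gamma>" "\<And>x. ?M x \<longleftrightarrow> \<phi> x = \<gamma> x"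
      using split_of_single_code[OF _ sc l T disc ij] by (metis finite_atLeastAtMost)
    have c1: "2 \<le> card K"
      using card_mono[of K "{i, j}"] K(1-3) ij(3) finite_subset[OF K(1) finI] by simp
    have "{?l, k} \<subseteq> ?N - K" using K(1,4) by auto
    then have "card {?l, k} \<le> card (?N - K)" by (rule card_mono[rotated]) simp
    moreover have "k \<noteq> ?l" using K(4) by blast
    ultimately have c2: "2 \<le> card (?N - K)" by simp
    show "reducible n h"
    \<comment> \<open>The equation is symmetric in its two sides, so whichever side contains the
      value coordinate plays the role of \<open>L\<close>.\<close>
    proof (cases "n \<in> K")
      case True
      show ?thesis
        by (rule reducible_if_split[OF assms(2) _ _ True c2 c1 K(6,5)]) (use K(1,7) in auto)
    next
      case False
      show ?thesis
        by (rule reducible_if_split[OF assms(2) _ _ _ c1 c2 K(5,6)]) (use K(1,7) False in auto)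
    qed
  next
    assume Q: "card (Qset n h a b) = 2 ^ (2 ^ (n - 1))"
    show "semilinear n h"
    proof (rule semilinear_if_flat[OF assms(1,2) T], rule ccontr)
      fix i j assume "i \<in> ?I" "j \<in> ?I" "i \<noteq> j" "\<not> flat ?D i j"
      from card_transversals_nonflat[OF finI dc this]
      show False using Q card_Q card_I by simp
    qed
  qed
qed

end
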